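(* Let $\mathbb{S}$ be a collection of subsets of $\{1,\dots,m\}$, each of size $l$. Let $\{\mathcal{B}_k\}_{k\in K}$ be a maximal set of mutually unbiased bases for $\mathbb{F}^m$, with $|K|=k_{\mathbb{F}^m}$, and let $\mathcal{P}=\{P^{\mathcal{B}_k}_{\mathcal{J}}: k\in K,\ \mathcal{J}\in\mathbb{S}\}$. If $\mathbb{S}$ is a Hadamard 3-design, then $\mathcal{P}$ is a maximal orthoplectic fusion frame of constant rank for $\mathbb{F}^m$. In particular: (1) if $m$ is a power of $2$, then $\mathcal{P}$ is a maximal orthoplectic fusion frame for $\mathbb{C}^m$; (2) if $m$ is a power of $4$, then $\mathcal{P}$ is a maximal orthoplectic fusion frame for $\mathbb{R}^m$. Conversely, if $\mathcal{P}$ is a maximal orthoplectic fusion frame of constant rank for $\mathbb{F}^m$, then $\mathbb{S}$ is a Hadamard 3-design.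
   Context: $\mathbb{F}$ is $\mathbb{R}$ or $\mathbb{C}$; $d_{\mathbb{R}^m}=\frac{m(m+1)}{2}-1$, $d_{\mathbb{C}^m}=m^2-1$; $k_{\mathbb{R}^m}=\frac m2+1$, $k_{\mathbb{C}^m}=m+1$ (these are upper bounds for the size of a set of mutually unbiased bases in $\mathbb{F}^m$; a set attaining them is called maximal; such sets exist in $\mathbb{C}^m$ if $m$ is a prime power and in $\mathbb{R}^m$ if $m$ is a power of $4$). Orthonormal bases $\{b_j\}_{j=1}^m,\{b'_j\}_{j=1}^m$ of $\mathbb{F}^m$ are mutually unbiased if $|\langle b_j,b'_{j'}\rangle|^2=\frac1m$ for all $j,j'$; a family of orthonormal bases is a set of mutually unbiased bases if every two distinct members are mutually unbiased. For an orthonormal basis $\mathcal{B}=\{b_j\}_{j=1}^m$ and $\mathcal{J}\subset\{1,\dots,m\}$, $P^{\mathcal{B}}_{\mathcal{J}}=\sum_{j\in\mathcal{J}}b_jb_j^*$. Embedded vectors: for an orthogonal projection $P$ on $\mathbb{F}^m$ of rank $l$, put $v_P=\frac{1}{r_l}\left(P-\frac{l}{m}I_m\right)$ with $r_l=\sqrt{l(m-l)/m}$, a unit vector in the real inner product space of traceless symmetric/Hermitian $m\times m$ matrices with $\langle A,B\rangle=\operatorname{tr}(AB)$, which is identified isometrically with $\mathbb{R}^{d_{\mathbb{F}^m}}$. An orthoplex in $\mathbb{R}^d$ is the union of an orthonormal basis with the negatives of its basis vectors. A family $\mathcal{P}$ of orthogonal projections on $\mathbb{F}^m$ is a maximal orthoplectic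 fusion frame if $|\mathcal{P}|=2d_{\mathbb{F}^m}$ and the embedded vectors of its elements form an orthoplex in $\mathbb{R}^{d_{\mathbb{F}^m}}$; it is of constant rank if all its elements have the same rank. Hadamard 3-design: a $3$-$(4t,2t,t-1)$ block design, i.e. a collection of $2t$-element subsets (blocks) of $\{1,\dots,4t\}$ such that every $3$-element subset lies in exactly $t-1$ blocks and every element lies in the same number of blocks, obtained from a Hadamard matrix as follows. Let $H=(h_{ij})$ be a Hadamard matrix of order $4t$ (entries $\pm1$, pairwise orthogonal rows) normalized so that all entries in the last row are $+1$; for each row $i$ other than the last put $\mathcal{J}_i=\{j: h_{ij}=+1\}$ and $\mathcal{J}_i'=\{j:h_{ij}=-1\}$. The design is the collection of all the sets $\mathcal{J}_i,\mathcal{J}_i'$, $1\le i\le 4t-1$.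
   Formalization: The converse is stated for m > 2 (it fails for m = 2 with S = {{1},{2}}, and for m = 1 over ℂ with S empty, as a Hadamard 3-design needs m = 4t points); in (1) and (2) the existence of such designs and bases is likewise asserted for m > 2. *)

theory Defs
  imports "HOL-Analysis.Analysis"
begin

text \<open>
  The scalar field is a set \<open>F\<close> of complex numbers, used only for \<open>F = \<real>\<close> and \<open>F = UNIV\<close>; the space
  \<open>F\<^sup>m\<close> is the set of vectors of type \<open>complex ^ 'n\<close> with all coordinates in \<open>F\<close>, where
  \<open>m = CARD('n)\<close>.  Over \<open>\<real>\<close>, conjugation is trivial, so Hermitian means symmetric.  Basis vectors
  and points of block designs are numbered by \<open>{1..m}\<close>.
\<close>

definition vec_over :: "complex set \<Rightarrow> (complex ^ 'n) set" where
  "vec_over F = {x. \<forall>i. x $ i \<in> F}"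

definition mat_over :: "complex set \<Rightarrow> (complex ^ 'n ^ 'n) set" where
  "mat_over F = {A. \<forall>i j. A $ i $ j \<in> F}"

definition cinner :: "complex ^ 'n \<Rightarrow> complex ^ 'n \<Rightarrow> complex" where
  "cinner x y = (\<Sum>i\<in>UNIV. x $ i * cnj (y $ i))"

definition ctranspose :: "complex ^ 'n ^ 'n \<Rightarrow> complex ^ 'n ^ 'n" where
  "ctranspose A = (\<chi> i j. cnj (A $ j $ i))"

text \<open>The matrix \<open>x x\<^sup>*\<close>.\<close>
definition outer :: "complex ^ 'n \<Rightarrow> complex ^ 'n ^ 'n" where
  "outer x = (\<chi> i j. x $ i * cnj (x $ j))"


subsection \<open>Mutually unbiased bases\<close>

definition orthonormal_basis :: "complex set \<Rightarrow> (nat \<Rightarrow> complex ^ 'n) \<Rightarrow> bool" where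
  "orthonormal_basis F b \<longleftrightarrow>
     (\<forall>j\<in>{1..CARD('n)}. b j \<in> vec_over F) \<and>
     (\<forall>i\<in>{1..CARD('n)}. \<forall>j\<in>{1..CARD('n)}. cinner (b i) (b j) = (if i = j then 1 else 0)) \<and>
     (\<forall>x\<in>vec_over F. \<exists>c. (\<forall>j. c j \<in> F) \<and> x = (\<Sum>j=1..CARD('n). c j *s b j))"

definition mutually_unbiased :: "(nat \<Rightarrow> complex ^ 'n) \<Rightarrow> (nat \<Rightarrow> complex ^ 'n) \<Rightarrow> bool" where
  "mutually_unbiased b b' \<longleftrightarrow>
     (\<forall>j\<in>{1..CARD('n)}. \<forall>j'\<in>{1..CARD('n)}.
        (cmod (cinner (b j) (b' j')))\<^sup>2 = 1 / real CARD('n))"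

definition mub_family :: "complex set \<Rightarrow> 'k set \<Rightarrow> ('k \<Rightarrow> nat \<Rightarrow> complex ^ 'n) \<Rightarrow> bool" where
  "mub_family F K B \<longleftrightarrow>
     (\<forall>k\<in>K. orthonormal_basis F (B k)) \<and>
     (\<forall>k\<in>K. \<forall>k'\<in>K. k \<noteq> k' \<longrightarrow> mutually_unbiased (B k) (B k'))"

text \<open>A real number, since \<open>m / 2 + 1\<close> is not an integer for odd \<open>m\<close> (no family then attains it).\<close>
definition mub_bound :: "complex set \<Rightarrow> nat \<Rightarrow> real" where
  "mub_bound F m = (if F = \<real> then real m / 2 + 1 else real m + 1)"

definition maximal_mub_family ::
    "complex set \<Rightarrow> 'k set \<Rightarrow> ('k \<Rightarrow> nat \<Rightarrow> complex ^ 'n) \<Rightarrow> bool" where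
  "maximal_mub_family F K B \<longleftrightarrow>
     mub_family F K B \<and> finite K \<and> real (card K) = mub_bound F CARD('n)"


subsection \<open>Maximal orthoplectic fusion frames\<close>

definition coord_proj :: "(nat \<Rightarrow> complex ^ 'n) \<Rightarrow> nat set \<Rightarrow> complex ^ 'n ^ 'n" where
  "coord_proj b J = (\<Sum>j\<in>J. outer (b j))"

definition orth_projection :: "complex set \<Rightarrow> complex ^ 'n ^ 'n \<Rightarrow> bool" where
  "orth_projection F P \<longleftrightarrow> P \<in> mat_over F \<and> P ** P = P \<and> ctranspose P = P"

definition traceless_hermitian :: "complex set \<Rightarrow> (complex ^ 'n ^ 'n) set" where
  "traceless_hermitian F = {A \<in> mat_over F. ctranspose A = A \<and> trace A = 0}"

text \<open>The dimension of the real vector space of traceless Hermitian matrices over \<open>F\<close>.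
  Both the division and the subtractions are exact for \<open>m \<ge> 1\<close>.\<close>
definition traceless_dim :: "complex set \<Rightarrow> nat \<Rightarrow> nat" where
  "traceless_dim F m = (if F = \<real> then m * (m + 1) div 2 - 1 else m\<^sup>2 - 1)"

text \<open>For \<open>P\<close> of rank \<open>0\<close> or \<open>m\<close> the normalising constant vanishes and \<open>embed P = 0\<close>, which never
  lies in an orthoplex.\<close>
definition embed :: "complex ^ 'n ^ 'n \<Rightarrow> complex ^ 'n ^ 'n" where
  "embed P =
     (let m = real CARD('n); l = real (rank P); r = sqrt (l * (m - l) / m)
      in (1 / r) *\<^sub>R (P - (l / m) *\<^sub>R mat 1))"

text \<open>Orthonormal bases and orthoplexes of a real space \<open>V\<close> of Hermitian matrices, with inner
  product \<open>tr (A B)\<close>; \<^const>\<open>span\<close> is the span over the reals.  For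
  \<open>V = traceless_hermitian F\<close> this is Euclidean space of dimension \<open>traceless_dim F m\<close>.\<close>
definition onb_of :: "(complex ^ 'n ^ 'n) set \<Rightarrow> (complex ^ 'n ^ 'n) set \<Rightarrow> bool" where
  "onb_of V E \<longleftrightarrow>
     E \<subseteq> V \<and> (\<forall>A\<in>E. \<forall>C\<in>E. trace (A ** C) = (if A = C then 1 else 0)) \<and> span E = V"

definition orthoplex_of :: "(complex ^ 'n ^ 'n) set \<Rightarrow> (complex ^ 'n ^ 'n) set \<Rightarrow> bool" where
  "orthoplex_of V X \<longleftrightarrow> (\<exists>E. onb_of V E \<and> X = E \<union> uminus ` E)"

definition max_orthoplectic_ff :: "complex set \<Rightarrow> (complex ^ 'n ^ 'n) set \<Rightarrow> bool" where
  "max_orthoplectic_ff F \<P> \<longleftrightarrow>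
     (\<forall>P\<in>\<P>. orth_projection F P) \<and>
     card \<P> = 2 * traceless_dim F CARD('n) \<and>
     orthoplex_of (traceless_hermitian F) (embed ` \<P>)"

definition constant_rank :: "(complex ^ 'n ^ 'n) set \<Rightarrow> bool" where
  "constant_rank \<P> \<longleftrightarrow> (\<exists>l. \<forall>P\<in>\<P>. rank P = l)"

definition mub_projections ::
    "'k set \<Rightarrow> ('k \<Rightarrow> nat \<Rightarrow> complex ^ 'n) \<Rightarrow> nat set set \<Rightarrow> (complex ^ 'n ^ 'n) set" where
  "mub_projections K B S = {coord_proj (B k) J | k J. k \<in> K \<and> J \<in> S}"


subsection \<open>Hadamard 3-designs\<close>

definition block_3_design :: "nat \<Rightarrow> nat \<Rightarrow> nat \<Rightarrow> nat set set \<Rightarrow> bool" where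
  "block_3_design v k lam S \<longleftrightarrow>
     (\<forall>J\<in>S. J \<subseteq> {1..v} \<and> card J = k) \<and>
     (\<forall>T. T \<subseteq> {1..v} \<and> card T = 3 \<longrightarrow> card {J \<in> S. T \<subseteq> J} = lam) \<and>
     (\<exists>r. \<forall>x\<in>{1..v}. card {J \<in> S. x \<in> J} = r)"

definition hadamard_matrix :: "nat \<Rightarrow> (nat \<Rightarrow> nat \<Rightarrow> int) \<Rightarrow> bool" where
  "hadamard_matrix n H \<longleftrightarrow>
     (\<forall>i\<in>{1..n}. \<forall>j\<in>{1..n}. H i j = 1 \<or> H i j = - 1) \<and>
     (\<forall>i\<in>{1..n}. \<forall>i'\<in>{1..n}. i \<noteq> i' \<longrightarrow> (\<Sum>j=1..n. H i j * H i' j) = 0)"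

text \<open>A Hadamard 3-design on \<open>{1..m}\<close>.\<close>
definition hadamard_3_design :: "nat \<Rightarrow> nat set set \<Rightarrow> bool" where
  "hadamard_3_design m S \<longleftrightarrow>
     (\<exists>t\<ge>1. m = 4 * t \<and> block_3_design (4 * t) (2 * t) (t - 1) S \<and>
        (\<exists>H. hadamard_matrix (4 * t) H \<and> (\<forall>j\<in>{1..4 * t}. H (4 * t) j = 1) \<and>
           S = (\<Union>i\<in>{1..4 * t - 1}.
                  {{j \<in> {1..4 * t}. H i j = 1}, {j \<in> {1..4 * t}. H i j = - 1}})))"

end

theory Submission
  imports Defs "HOL-Algebra.Algebraic_Closure_Type" "HOL-Library.Z2"
begin

text \<open>
  Give Hermitian matrices the inner product \<open>tr (A C)\<close>.  Two coordinate projections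
  \<open>P\<^sub>J, P\<^sub>L\<close> of rank \<open>l\<close> taken from one orthonormal basis have inner product \<open>card (J \<inter> L)\<close>;
  taken from two mutually unbiased bases they have inner product \<open>l\<^sup>2 / m\<close>, which is the inner
  product of their scalar parts.  After embedding, vectors of different bases are therefore
  orthogonal, and within one basis the inner product is an increasing affine function of
  \<open>card (J \<inter> L)\<close> (\<open>trace_embed_same_basis\<close>, \<open>trace_embed_unbiased\<close>).

  The blocks of a Hadamard 3-design have \<open>m / 2\<close> points, come in complementary pairs, and blocks
  of different pairs meet in \<open>m / 4\<close> points.  The embedded vectors of a pair are then antipodal
  and those of different pairs are orthogonal.  A maximal set of mutually unbiased bases yields
  (number of bases) \<open>* (m - 1)\<close> pairs, which is exactly the dimension of the space of traceless
  Hermitian matrices, so one vector of each pair gives an orthonormal basis of that space.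

  Conversely, in an orthoplex the antipode of the vector of \<open>P\<^sub>J\<close> is not orthogonal to it, so it
  belongs to the same basis.  Comparing the diagonals of the two projections in that basis forces
  \<open>l = m / 2\<close> and shows that the antipode comes from the complement of \<open>J\<close>.  All remaining inner
  products vanish, so the remaining blocks meet \<open>J\<close> in \<open>m / 4\<close> points.  Counting gives \<open>m - 1\<close>
  complementary pairs; their members through the point \<open>m\<close> are the rows of a Hadamard matrix.
  Such a matrix always yields a 3-design, because its columns are orthogonal as well
  (\<open>hadamard_matrix_imp_3_design\<close>).

  For the two special cases the required objects are built on the field \<open>E\<close> with \<open>2\<^sup>N\<close> elements,
  realised inside the algebraic closure of the field with two elements.  The signs of
  \<open>tr (x y)\<close> form a Hadamard matrix.  A unimodular function \<open>f\<close> on a finite group with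
  \<open>f (x + y) = f x * f y * \<beta> x y\<close> for a nondegenerate bicharacter \<open>\<beta>\<close> satisfies
  \<open>\<bar>\<Sum>x. f x\<bar>\<^sup>2 = card G\<close>, as a Gauss sum does (\<open>sum_quadratic_phase\<close>).  Hence a family of such phases
  whose quotients all have nondegenerate bicharacters yields, after multiplication by the characters
  of the group, mutually unbiased bases, to which the standard basis can be added
  (\<open>quadratic_phase_mubs\<close>).  Over the complex numbers the phases are fourth roots of unity on
  \<open>E\<close> with bicharacters \<open>(-1)\<^bsup>tr (c\<^sup>2 x y)\<^esup>\<close>; over the real numbers they are the signs of Kerdock's
  quadratic forms on \<open>E \<times> {0, 1}\<close> with \<open>N\<close> odd.
\<close>

section \<open>Hadamard matrices and 3-designs\<close>

text \<open>
  Both sides are the trace of \<open>(H\<^sup>T H)\<^sup>2\<close>, which equals the trace of \<open>(H H\<^sup>T)\<^sup>2\<close>.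
\<close>
lemma sum_squares_column_row_products:
  fixes H :: "nat \<Rightarrow> nat \<Rightarrow> int"
  shows "(\<Sum>j\<in>A. \<Sum>j'\<in>A. (\<Sum>i\<in>A. H i j * H i j')\<^sup>2) = (\<Sum>i\<in>A. \<Sum>i'\<in>A. (\<Sum>j\<in>A. H i j * H i' j)\<^sup>2)"
proof -
  have "(\<Sum>j\<in>A. \<Sum>j'\<in>A. (\<Sum>i\<in>A. H i j * H i j')\<^sup>2)
      = (\<Sum>j\<in>A. \<Sum>j'\<in>A. \<Sum>i\<in>A. \<Sum>i'\<in>A. (H i j * H i' j) * (H i j' * H i' j'))"
    by (simp add: power2_eq_square sum_product mult_ac)
  also have "\<dots> = (\<Sum>j\<in>A. \<Sum>i\<in>A. \<Sum>j'\<in>A. \<Sum>i'\<in>A. (H i j * H i' j) * (H i j' * H i' j'))"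
    by (intro sum.cong refl sum.swap)
  also have "\<dots> = (\<Sum>i\<in>A. \<Sum>j\<in>A. \<Sum>j'\<in>A. \<Sum>i'\<in>A. (H i j * H i' j) * (H i j' * H i' j'))"
    by (rule sum.swap)
  also have "\<dots> = (\<Sum>i\<in>A. \<Sum>j\<in>A. \<Sum>i'\<in>A. \<Sum>j'\<in>A. (H i j * H i' j) * (H i j' * H i' j'))"
    by (intro sum.cong refl sum.swap)
  also have "\<dots> = (\<Sum>i\<in>A. \<Sum>i'\<in>A. \<Sum>j\<in>A. \<Sum>j'\<in>A. (H i j * H i' j) * (H i j' * H i' j'))"
    by (intro sum.cong refl sum.swap)
  finally show ?thesis
    by (simp add: power2_eq_square sum_product)
qed

lemma hadamard_entry:
  "hadamard_matrix n H \<Longrightarrow> i \<in> {1..n} \<Longrightarrow> j \<in> {1..n} \<Longrightarrow> H i j \<in> {1, - 1}"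
  unfolding hadamard_matrix_def by blast

lemma hadamard_entry_square:
  "hadamard_matrix n H \<Longrightarrow> i \<in> {1..n} \<Longrightarrow> j \<in> {1..n} \<Longrightarrow> H i j * H i j = 1"
  using hadamard_entry[of n H i j] by auto

text \<open>
  Let \<open>C = H\<^sup>T H\<close>.  The squares of the entries of \<open>C\<close> have the same sum \<open>n\<^sup>3\<close> as those of
  \<open>H H\<^sup>T = n I\<close>.  The diagonal of \<open>C\<close>, all of whose entries are \<open>n\<close>, already contributes \<open>n\<^sup>3\<close>, so
  nothing is left for the other entries.
\<close>
lemma hadamard_columns_orthogonal:
  assumes H: "hadamard_matrix n H" and j: "j \<in> {1..n}" "j' \<in> {1..n}" "j \<noteq> j'"
  shows "(\<Sum>i=1..n. H i j * H i j') = 0"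
proof -
  define C where "C j j' = (\<Sum>i=1..n. H i j * H i j')" for j j'
  define A where "A = {1..n}"
  have row: "(\<Sum>j\<in>A. H i j * H i' j) = (if i = i' then int n else 0)" if "i \<in> A" "i' \<in> A" for i i'
    using that H hadamard_entry_square[OF H] by (auto simp: A_def hadamard_matrix_def)
  have diag: "C j j = int n" if "j \<in> A" for j
    using that hadamard_entry_square[OF H] by (simp add: C_def A_def)
  have "(\<Sum>j\<in>A. \<Sum>j'\<in>A. (C j j')\<^sup>2) = (\<Sum>i\<in>A. \<Sum>i'\<in>A. (\<Sum>j\<in>A. H i j * H i' j)\<^sup>2)"
    unfolding C_def A_def[symmetric] by (rule sum_squares_column_row_products)
  also have "\<dots> = (\<Sum>i\<in>A. \<Sum>i'\<in>A. if i = i' then (int n)\<^sup>2 else 0)"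
    by (intro sum.cong refl) (simp only: row, simp)
  also have "\<dots> = (\<Sum>i\<in>A. (int n)\<^sup>2)"
    by (intro sum.cong refl) (simp add: A_def)
  also have "\<dots> = (\<Sum>j\<in>A. (C j j)\<^sup>2)"
    using diag by simp
  finally have eq: "(\<Sum>j\<in>A. \<Sum>j'\<in>A. (C j j')\<^sup>2) = (\<Sum>j\<in>A. (C j j)\<^sup>2)" .
  have "(\<Sum>j\<in>A. \<Sum>j'\<in>A. (C j j')\<^sup>2) = (\<Sum>j\<in>A. (C j j)\<^sup>2 + (\<Sum>j'\<in>A - {j}. (C j j')\<^sup>2))"
    by (intro sum.cong refl sum.remove) (auto simp: A_def)
  then have "(\<Sum>j\<in>A. \<Sum>j'\<in>A - {j}. (C j j')\<^sup>2) = 0"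
    using eq by (simp add: sum.distrib)
  then have "\<forall>j\<in>A. (\<Sum>j'\<in>A - {j}. (C j j')\<^sup>2) = 0"
    by (subst (asm) sum_nonneg_eq_0_iff) (auto simp: A_def intro: sum_nonneg)
  then have "(\<Sum>j'\<in>A - {j}. (C j j')\<^sup>2) = 0"
    using j by (simp add: A_def)
  then have "(C j j')\<^sup>2 = 0"
    using j by (subst (asm) sum_nonneg_eq_0_iff) (auto simp: A_def)
  then show ?thesis by (simp add: C_def)
qed

definition sign_block :: "nat \<Rightarrow> (nat \<Rightarrow> nat \<Rightarrow> int) \<Rightarrow> nat \<Rightarrow> int \<Rightarrow> nat set" where
  "sign_block n H i s = {j \<in> {1..n}. H i j = s}"

lemma hadamard_row_sum:
  assumes H: "hadamard_matrix n H" and last: "\<forall>j\<in>{1..n}. H n j = 1" and i: "i \<in> {1..n - 1}"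
  shows "(\<Sum>j=1..n. H i j) = 0"
proof -
  have "i \<in> {1..n}" "n \<in> {1..n}" "i \<noteq> n" using i by auto
  then have "(\<Sum>j=1..n. H i j * H n j) = 0"
    using H unfolding hadamard_matrix_def by blast
  also have "(\<Sum>j=1..n. H i j * H n j) = (\<Sum>j=1..n. H i j)"
    using last by (intro sum.cong) auto
  finally show ?thesis .
qed

text \<open>
  For signs \<open>a, b, s, s'\<close> the indicator of \<open>a = s \<and> b = s'\<close> is \<open>(1 + s a) (1 + s' b) / 4\<close>.  Summed over
  a row, the linear terms vanish because the rows are orthogonal to the constant last row, and the
  mixed term vanishes because the two rows are orthogonal to each other.
\<close>
lemma card_sign_block_Int:
  assumes H: "hadamard_matrix n H" and last: "\<forall>j\<in>{1..n}. H n j = 1"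
    and i: "i \<in> {1..n - 1}" "i' \<in> {1..n - 1}" "i \<noteq> i'"
    and s: "s \<in> {1, - 1}" "s' \<in> {1, - 1}"
  shows "4 * card (sign_block n H i s \<inter> sign_block n H i' s') = n"
proof -
  have z: "(\<Sum>j=1..n. H i j * H i' j) = 0"
    using H i by (auto simp: hadamard_matrix_def)
  note z' = hadamard_row_sum[OF H last i(1)] hadamard_row_sum[OF H last i(2)]
  have "int (4 * card (sign_block n H i s \<inter> sign_block n H i' s'))
      = (\<Sum>j=1..n. if H i j = s \<and> H i' j = s' then 4 else 0)"
    by (subst sum.inter_filter[symmetric]) (auto simp: sign_block_def intro!: arg_cong[of _ _ card])
  also have "\<dots> = (\<Sum>j=1..n. 1 + s * H i j + s' * H i' j + s * s' * (H i j * H i' j))"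
  proof (rule sum.cong)
    fix j assume j: "j \<in> {1..n}"
    have "H i j \<in> {1, - 1}" "H i' j \<in> {1, - 1}"
      using hadamard_entry[OF H, of i j] hadamard_entry[OF H, of i' j] i j by auto
    then show "(if H i j = s \<and> H i' j = s' then 4 else 0) = 1 + s * H i j + s' * H i' j + s * s' * (H i j * H i' j)"
      using s by auto
  qed simp
  also have "\<dots> = int n"
    using z z' by (simp add: sum.distrib flip: sum_distrib_left)
  finally show ?thesis by presburger
qed

lemma card_sign_block:
  assumes H: "hadamard_matrix n H" and last: "\<forall>j\<in>{1..n}. H n j = 1"
    and i: "i \<in> {1..n - 1}" and s: "s \<in> {1, - 1}"
  shows "2 * card (sign_block n H i s) = n"
proof -
  note z = hadamard_row_sum[OF H last i]
  have "int (2 * card (sign_block n H i s)) = (\<Sum>j=1..n. if H i j = s then 2 else 0)"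
    by (subst sum.inter_filter[symmetric]) (auto simp: sign_block_def)
  also have "\<dots> = (\<Sum>j=1..n. 1 + s * H i j)"
  proof (rule sum.cong)
    fix j assume j: "j \<in> {1..n}"
    have "H i j \<in> {1, - 1}"
      using hadamard_entry[OF H, of i j] i j by auto
    then show "(if H i j = s then 2 else 0) = 1 + s * H i j" using s by auto
  qed simp
  also have "\<dots> = int n"
    using z by (simp add: sum.distrib flip: sum_distrib_left)
  finally show ?thesis by presburger
qed

text \<open>
  Two equal blocks from different rows would meet in \<open>n / 2\<close> points instead of \<open>n / 4\<close>.  This is what
  allows blocks to be counted by rows.
\<close>
lemma sign_block_inj:
  assumes H: "hadamard_matrix n H" and last: "\<forall>j\<in>{1..n}. H n j = 1" and n: "n > 0"
  shows "inj_on (\<lambda>(i, s). sign_block n H i s) ({1..n - 1} \<times> {1, - 1})"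
proof (rule inj_onI, clarify)
  fix i s i' s'
  assume i: "i \<in> {1..n - 1}" "i' \<in> {1..n - 1}" and s: "s \<in> {1, - 1::int}" "s' \<in> {1, - 1}"
    and eq: "sign_block n H i s = sign_block n H i' s'"
  have "i = i'"
  proof (rule ccontr)
    assume "i \<noteq> i'"
    from card_sign_block_Int[OF H last i this s] card_sign_block[OF H last i(2) s(2)]
    show False using eq n by simp
  qed
  moreover have "sign_block n H i s \<noteq> {}"
    using card_sign_block[OF H last i(1) s(1)] n by (intro notI) simp
  ultimately show "i = i' \<and> s = s'" using eq by (auto simp: sign_block_def)
qed

lemma hadamard_blocks_eq:
  "(\<Union>i\<in>{1..n - 1}. {{j \<in> {1..n}. H i j = 1}, {j \<in> {1..n}. H i j = - 1}})
   = (\<lambda>(i, s). sign_block n H i s) ` ({1..n - 1} \<times> {1, - 1::int})"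
  by (auto simp: sign_block_def)

text \<open>
  A row contributes a block containing \<open>T\<close> exactly if it is constant on \<open>T\<close>, and then only the
  block of the sign that it takes there.
\<close>
lemma card_blocks_containing:
  assumes H: "hadamard_matrix n H" and last: "\<forall>j\<in>{1..n}. H n j = 1" and n: "n > 0"
    and T: "T \<subseteq> {1..n}" "a \<in> T"
  shows "card {J \<in> (\<lambda>(i, s). sign_block n H i s) ` ({1..n - 1} \<times> {1, - 1}). T \<subseteq> J}
       = card {i \<in> {1..n - 1}. \<forall>b\<in>T. H i b = H i a}"
proof -
  have pm: "H i a \<in> {1, - 1}" if "i \<in> {1..n-1}" for i
    using that T by (intro hadamard_entry[OF H]) auto
  have "{J \<in> (\<lambda>(i, s). sign_block n H i s) ` ({1..n - 1} \<times> {1, - 1}). T \<subseteq> J}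
      = (\<lambda>(i, s). sign_block n H i s) ` ((\<lambda>i. (i, H i a)) ` {i \<in> {1..n - 1}. \<forall>b\<in>T. H i b = H i a})"
    (is "?L = ?R")
  proof
    show "?L \<subseteq> ?R"
    proof
      fix J assume "J \<in> ?L"
      then obtain i s where *: "i \<in> {1..n-1}" "J = sign_block n H i s" "T \<subseteq> J" by auto
      then have const: "\<forall>b\<in>T. H i b = s" by (auto simp: sign_block_def)
      then have "J = (\<lambda>(i, s). sign_block n H i s) (i, H i a)" using * T by simp
      moreover have "(i, H i a) \<in> (\<lambda>i. (i, H i a)) ` {i \<in> {1..n - 1}. \<forall>b\<in>T. H i b = H i a}"
        using * const T by (intro imageI) auto
      ultimately show "J \<in> ?R" by (rule image_eqI)
    qed
    show "?R \<subseteq> ?L"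
    proof
      fix J assume "J \<in> ?R"
      then obtain i where i: "i \<in> {1..n - 1}" "\<forall>b\<in>T. H i b = H i a" "J = sign_block n H i (H i a)"
        by auto
      then have "J \<in> (\<lambda>(i, s). sign_block n H i s) ` ({1..n - 1} \<times> {1, - 1})"
        using pm[OF i(1)] by (intro image_eqI[of _ _ "(i, H i a)"]) auto
      then show "J \<in> ?L" using i T(1) by (auto simp: sign_block_def)
    qed
  qed
  moreover have "inj_on (\<lambda>(i, s). sign_block n H i s) ((\<lambda>i. (i, H i a)) ` {i \<in> {1..n - 1}. \<forall>b\<in>T. H i b = H i a})"
    using pm by (intro inj_on_subset[OF sign_block_inj[OF H last n]]) auto
  ultimately show ?thesis
    by (simp add: card_image inj_on_def[of "\<lambda>i. (i, H i a)"])
qed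

text \<open>
  For signs \<open>x, y, z\<close> the indicator of \<open>x = y = z\<close> is \<open>(1 + x y + y z + x z) / 4\<close>.  Summed over all
  rows, the products vanish by orthogonality of columns, so exactly \<open>t\<close> rows are constant on a given
  triple.  One of them is the last row, which gives no blocks.
\<close>
lemma hadamard_matrix_imp_3_design:
  assumes H: "hadamard_matrix (4 * t) H" and last: "\<forall>j\<in>{1..4 * t}. H (4 * t) j = 1" and t: "t \<ge> 1"
  shows "hadamard_3_design (4 * t)
    (\<Union>i\<in>{1..4 * t - 1}. {{j \<in> {1..4 * t}. H i j = 1}, {j \<in> {1..4 * t}. H i j = - 1}})"
    (is "hadamard_3_design _ ?S")
proof -
  define n where "n = 4 * t"
  have n: "n > 0" using t by (simp add: n_def)
  note H' = H[folded n_def] and last' = last[folded n_def]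
  define S where "S = (\<lambda>(i, s). sign_block n H i s) ` ({1..n - 1} \<times> {1, - 1::int})"
  have S: "?S = S" unfolding S_def n_def[symmetric] by (rule hadamard_blocks_eq)
  have "block_3_design n (2 * t) (t - 1) S"
    unfolding block_3_design_def
  proof (intro conjI ballI allI impI)
    fix J assume "J \<in> S"
    then obtain p where p: "p \<in> {1..n - 1} \<times> {1, - 1 :: int}" "J = (\<lambda>(i, s). sign_block n H i s) p"
      unfolding S_def by blast
    define i s where "i = fst p" and "s = snd p"
    have J: "i \<in> {1..n - 1}" "s \<in> {1, - 1}" "J = sign_block n H i s"
      using p by (auto simp: i_def s_def)
    then show "J \<subseteq> {1..n}" by (auto simp: sign_block_def)
    show "card J = 2 * t"
      using card_sign_block[OF H' last' J(1,2)] J(3) by (simp add: n_def)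
  next
    fix T assume T: "T \<subseteq> {1..n} \<and> card T = 3"
    then obtain a b c where abc: "T = {a, b, c}" "a \<noteq> b" "b \<noteq> c" "a \<noteq> c"
      by (auto simp: card_3_iff)
    then have mem: "a \<in> {1..n}" "b \<in> {1..n}" "c \<in> {1..n}" using T by auto
    define Q where "Q i \<longleftrightarrow> H i a = H i b \<and> H i b = H i c" for i
    have "{i \<in> {1..n - 1}. \<forall>x\<in>T. H i x = H i a} = {i \<in> {1..n}. Q i} - {n}"
      by (auto simp: abc Q_def)
    moreover have "n \<in> {i \<in> {1..n}. Q i}"
      using mem last' n by (simp add: Q_def)
    ultimately have "card {i \<in> {1..n - 1}. \<forall>x\<in>T. H i x = H i a} = card {i \<in> {1..n}. Q i} - 1"
      by (simp add: card_Diff_singleton)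
    moreover have "int (4 * card {i \<in> {1..n}. Q i}) = int n"
    proof -
      have "int (4 * card {i \<in> {1..n}. Q i}) = (\<Sum>i=1..n. if Q i then 4 else 0)"
        by (subst sum.inter_filter[symmetric]) auto
      also have "\<dots> = (\<Sum>i=1..n. 1 + H i a * H i b + H i b * H i c + H i a * H i c)"
      proof (rule sum.cong)
        fix i assume i: "i \<in> {1..n}"
        note entries = hadamard_entry[OF H' i mem(1)] hadamard_entry[OF H' i mem(2)] hadamard_entry[OF H' i mem(3)]
        from entries show "(if Q i then 4 else 0) = 1 + H i a * H i b + H i b * H i c + H i a * H i c"
          by (auto simp: Q_def)
      qed simp
      also have "\<dots> = int n"
        using hadamard_columns_orthogonal[OF H'] mem abc by (simp add: sum.distrib)
      finally show ?thesis .
    qed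
    ultimately show "card {J \<in> S. T \<subseteq> J} = t - 1"
      using card_blocks_containing[OF H' last' n, of T a] T abc by (simp add: S_def n_def)
  next
    have "card {J \<in> S. x \<in> J} = n - 1" if "x \<in> {1..n}" for x
    proof -
      have "{i \<in> {1..n - 1}. \<forall>b\<in>{x}. H i b = H i x} = {1..n - 1}" by auto
      then show ?thesis
        using card_blocks_containing[OF H' last' n, of "{x}" x] that
        unfolding S_def[symmetric] by simp
    qed
    then show "\<exists>r. \<forall>x\<in>{1..n}. card {J \<in> S. x \<in> J} = r" by blast
  qed
  then show ?thesis
    using t H last unfolding hadamard_3_design_def S[symmetric] n_def by blast
qed

section \<open>Hermitian matrices\<close>

lemma trace_mult: "trace (A ** B) = (\<Sum>i\<in>UNIV. \<Sum>k\<in>UNIV. A $ i $ k * B $ k $ i)"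
  for A B :: "complex ^ 'n ^ 'n"
  by (simp add: trace_def matrix_matrix_mult_def)

lemma scaleR_complex: "c *\<^sub>R (z::complex) = of_real c * z"
  by (rule scaleR_conv_of_real)

lemma trace_scaleR: "trace (c *\<^sub>R A) = of_real c * trace A" for A :: "complex ^ 'n ^ 'n"
  by (simp add: trace_def sum_distrib_left scaleR_complex)

lemma trace_mult_scaleR:
  fixes A B :: "complex ^ 'n ^ 'n"
  shows "trace ((c *\<^sub>R A) ** B) = of_real c * trace (A ** B)"
    and "trace (A ** (c *\<^sub>R B)) = of_real c * trace (A ** B)"
  by (simp_all add: trace_mult sum_distrib_left scaleR_complex mult_ac)

lemma trace_mult_diff:
  fixes A B C :: "complex ^ 'n ^ 'n"
  shows "trace ((A - B) ** C) = trace (A ** C) - trace (B ** C)"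
    and "trace (A ** (B - C)) = trace (A ** B) - trace (A ** C)"
  by (simp_all add: trace_mult sum_subtractf algebra_simps)

lemma trace_mult_uminus:
  fixes A B :: "complex ^ 'n ^ 'n"
  shows "trace ((- A) ** B) = - trace (A ** B)" and "trace (A ** (- B)) = - trace (A ** B)"
  by (simp_all add: trace_mult sum_negf)

lemma trace_zero [simp]: "trace (0 :: complex ^ 'n ^ 'n) = 0"
  by (simp add: trace_def)

lemma trace_sum: "trace (sum f S) = (\<Sum>x\<in>S. trace (f x))" for f :: "'b \<Rightarrow> complex ^ 'n ^ 'n"
  by (induction S rule: infinite_finite_induct) (auto simp: trace_add)

lemma trace_mult_sum:
  fixes f :: "'b \<Rightarrow> complex ^ 'n ^ 'n"
  shows "trace (sum f S ** B) = (\<Sum>x\<in>S. trace (f x ** B))"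
    and "trace (B ** sum f S) = (\<Sum>x\<in>S. trace (B ** f x))"
proof -
  show "trace (sum f S ** B) = (\<Sum>x\<in>S. trace (f x ** B))"
    by (induction S rule: infinite_finite_induct)
       (auto simp: trace_mult sum.distrib algebra_simps)
  show "trace (B ** sum f S) = (\<Sum>x\<in>S. trace (B ** f x))"
    by (induction S rule: infinite_finite_induct)
       (auto simp: trace_mult sum.distrib algebra_simps)
qed

lemma cinner_commute: "cinner x y = cnj (cinner y x)"
  by (simp add: cinner_def mult.commute)

lemma trace_outer: "trace (outer x) = cinner x x"
  by (simp add: trace_def outer_def cinner_def)

lemma trace_outer_mult: "trace (outer x ** outer y) = of_real ((cmod (cinner x y))\<^sup>2)"
proof -
  have "trace (outer x ** outer y) = cinner x y * cinner y x"
    by (simp add: trace_mult outer_def cinner_def sum_product mult_ac)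
  also have "\<dots> = of_real ((cmod (cinner x y))\<^sup>2)"
    by (subst cinner_commute[of y x]) (rule complex_norm_square[symmetric])
  finally show ?thesis .
qed

lemma cinner_sum_left: "cinner (sum f S) y = (\<Sum>x\<in>S. cinner (f x) y)"
  by (simp add: cinner_def sum_distrib_right) (rule sum.swap)

lemma cinner_scale_left: "cinner (c *s x) y = c * cinner x y"
  by (simp add: cinner_def sum_distrib_left mult_ac)

text \<open>
  Pairing a vanishing linear combination with one of the vectors isolates its coefficient.
\<close>
lemma orthonormal_independent:
  fixes c :: "'b \<Rightarrow> complex ^ 'n"
  assumes fin: "finite J" and on: "\<And>i j. i \<in> J \<Longrightarrow> j \<in> J \<Longrightarrow> cinner (c i) (c j) = (if i = j then 1 else 0)"
  shows "inj_on c J" and "vec.independent (c ` J)"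
proof -
  show inj: "inj_on c J"
    by (rule inj_onI) (metis on zero_neq_one)
  show "vec.independent (c ` J)"
  proof (subst vec.dependent_finite)
    show "finite (c ` J)" using fin by simp
    have "u (c j) = 0" if 0: "(\<Sum>v\<in>c ` J. u v *s v) = 0" and j: "j \<in> J" for u j
    proof -
      have "0 = cinner (\<Sum>i\<in>J. u (c i) *s c i) (c j)"
        using 0 by (simp add: sum.reindex[OF inj]) (simp add: cinner_def)
      also have "\<dots> = (\<Sum>i\<in>J. if i = j then u (c j) else 0)"
        unfolding cinner_sum_left by (intro sum.cong) (auto simp: cinner_scale_left on j)
      also have "\<dots> = u (c j)" using fin j by simp
      finally show ?thesis by simp
    qed
    then show "\<not> (\<exists>u. (\<exists>v\<in>c ` J. u v \<noteq> 0) \<and> (\<Sum>v\<in>c ` J. u v *s v) = 0)" by auto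
  qed
qed

text \<open>
  The constant \<^const>\<open>rank\<close> is the dimension of the row space.  The rows are combinations of the
  conjugates of the vectors \<open>b j\<close>, and conversely each conjugate is a combination of the rows, with
  the entries of \<open>b j\<close> (conjugated) as coefficients.
\<close>
lemma rank_coord_proj:
  fixes b :: "nat \<Rightarrow> complex ^ 'n"
  assumes fin: "finite J" and on: "\<And>i j. i \<in> J \<Longrightarrow> j \<in> J \<Longrightarrow> cinner (b i) (b j) = (if i = j then 1 else 0)"
  shows "rank (coord_proj b J) = card J"
proof -
  define c where "c j = (\<chi> k. cnj (b j $ k))" for j
  let ?P = "coord_proj b J"
  have on': "cinner (c i) (c j) = (if i = j then 1 else 0)" if "i \<in> J" "j \<in> J" for i j
    using on[OF that(2,1)] by (simp add: cinner_def c_def mult.commute split: if_splits)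
  have row: "row i ?P = (\<Sum>j\<in>J. b j $ i *s c j)" for i
    by (simp add: vec_eq_iff row_def coord_proj_def outer_def c_def)
  have "c j = (\<Sum>i\<in>UNIV. cnj (b j $ i) *s row i ?P)" if j: "j \<in> J" for j
  proof (subst vec_eq_iff, intro allI)
    fix k
    have "(\<Sum>i\<in>UNIV. cnj (b j $ i) *s row i ?P) $ k = (\<Sum>j'\<in>J. cinner (b j') (b j) * c j' $ k)"
      unfolding row cinner_def
      by (simp add: sum_distrib_left sum_distrib_right mult_ac) (rule sum.swap)
    also have "\<dots> = (\<Sum>j'\<in>J. if j' = j then c j $ k else 0)"
      using on j by (intro sum.cong) auto
    also have "\<dots> = c j $ k" using fin j by simp
    finally show "c j $ k = (\<Sum>i\<in>UNIV. cnj (b j $ i) *s row i ?P) $ k" by simp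
  qed
  then have "c j \<in> vec.span (rows ?P)" if "j \<in> J" for j
    using that by (metis (mono_tags, lifting) UNIV_I mem_Collect_eq rows_def vec.span_base vec.span_scale vec.span_sum)
  moreover have "row i ?P \<in> vec.span (c ` J)" for i
    unfolding row by (intro vec.span_sum vec.span_scale vec.span_base) auto
  ultimately have "vec.span (rows ?P) = vec.span (c ` J)"
    by (subst vec.span_eq) (auto simp: rows_def)
  then have "rank ?P = vec.dim (c ` J)"
    unfolding row_rank_def_gen by (metis vec.dim_span)
  also have "\<dots> = card (c ` J)"
    by (rule vec.dim_eq_card_independent) (rule orthonormal_independent(2)[OF fin on'])
  also have "\<dots> = card J"
    by (rule card_image) (rule orthonormal_independent(1)[OF fin on'])
  finally show ?thesis .
qed


definition hermitian :: "complex set \<Rightarrow> (complex ^ 'n ^ 'n) set" where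
  "hermitian F = {A \<in> mat_over F. ctranspose A = A}"

lemma traceless_hermitian_eq: "traceless_hermitian F = {A \<in> hermitian F. trace A = 0}"
  by (auto simp: traceless_hermitian_def hermitian_def)

lemma subspace_hermitian:
  assumes "F = \<real> \<or> F = UNIV" shows "subspace (hermitian F)"
  using assms
  by (auto simp: subspace_def hermitian_def mat_over_def ctranspose_def vec_eq_iff Reals_add
      scaleR_complex)

lemma subspace_traceless_hermitian:
  assumes "F = \<real> \<or> F = UNIV" shows "subspace (traceless_hermitian F)"
  using subspace_hermitian[OF assms]
  by (auto simp: subspace_def traceless_hermitian_eq trace_add trace_scaleR)

lemma hermitian_nth: "A \<in> hermitian F \<Longrightarrow> A $ j $ i = cnj (A $ i $ j)"
  by (auto simp: hermitian_def ctranspose_def vec_eq_iff)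

text \<open>
  The Euclidean inner product of complex matrices is the real part of \<open>tr (A C\<^sup>*)\<close>, so the library's
  theory of orthogonality and dimension applies to the trace form.
\<close>
lemma inner_eq_trace:
  assumes "C \<in> hermitian F"
  shows "inner A C = Re (trace (A ** C))"
proof -
  have "Re (A $ i $ k * C $ k $ i) = inner (A $ i $ k) (C $ i $ k)" for i k
    by (subst hermitian_nth[OF assms, of k i]) (simp add: inner_complex_def)
  then show ?thesis by (simp add: trace_mult inner_vec_def)
qed

text \<open>
  The real part of a Hermitian matrix is symmetric and its imaginary part is antisymmetric.  Their
  sum is a real matrix from which both can be recovered, which embeds the Hermitian matrices
  into a space of dimension \<open>m\<^sup>2\<close>.
\<close>
lemma dim_hermitian_complex: "dim (hermitian UNIV :: (complex ^ 'n ^ 'n) set) \<le> CARD('n)\<^sup>2"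
proof -
  define \<phi> :: "complex ^ 'n ^ 'n \<Rightarrow> real ^ 'n ^ 'n" where
    "\<phi> A = (\<chi> i j. Re (A $ i $ j) + Im (A $ i $ j))" for A
  have lin: "linear \<phi>"
    by (rule linearI) (simp_all add: \<phi>_def vec_eq_iff algebra_simps)
  have "inj_on \<phi> (span (hermitian UNIV))"
  proof -
    have "A = 0" if A: "A \<in> hermitian UNIV" and 0: "\<phi> A = 0" for A :: "complex ^ 'n ^ 'n"
    proof -
      have "A $ i $ j = 0" for i j
      proof -
        have "Re (A $ i $ j) + Im (A $ i $ j) = 0" "Re (A $ j $ i) + Im (A $ j $ i) = 0"
          using 0 by (simp_all add: \<phi>_def vec_eq_iff)
        then show ?thesis
          using hermitian_nth[OF A, of j i] by (simp add: complex_eq_iff)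
      qed
      then show ?thesis by (simp add: vec_eq_iff)
    qed
    moreover have sub: "subspace (hermitian UNIV :: (complex ^ 'n ^ 'n) set)"
      by (rule subspace_hermitian) simp
    ultimately have "inj_on \<phi> (hermitian UNIV)"
      using linear_injective_on_subspace_0[OF lin sub] by blast
    then show ?thesis
      using sub by (metis span_eq_iff)
  qed
  then have "dim (hermitian UNIV :: (complex ^ 'n ^ 'n) set) = dim (\<phi> ` hermitian UNIV)"
    by (rule dim_image_eq[OF lin, symmetric])
  also have "\<dots> \<le> DIM(real ^ 'n ^ 'n)"
    by (rule dim_subset_UNIV)
  finally show ?thesis by (simp add: power2_eq_square)
qed

text \<open>
  A real symmetric matrix is a function on the sets \<open>{i, j}\<close>, of which there are \<open>m\<close> with one element
  and \<open>m choose 2\<close> with two.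
\<close>
lemma dim_hermitian_real:
  "dim (hermitian \<real> :: (complex ^ 'n ^ 'n) set) \<le> CARD('n) * (CARD('n) + 1) div 2"
proof -
  define M :: "'n set \<Rightarrow> complex ^ 'n ^ 'n" where
    "M s = (\<chi> i j. if {i, j} = s then 1 else 0)" for s
  define U :: "'n set set" where "U = {s. card s = 1} \<union> {s. card s = 2}"
  have pair: "{i, j} \<in> U" for i j :: 'n
    by (cases "i = j") (auto simp: U_def)
  have "hermitian \<real> \<subseteq> span (M ` U)"
  proof
    fix A :: "complex ^ 'n ^ 'n" assume A: "A \<in> hermitian \<real>"
    define a where "a s = (SOME r. \<exists>i j. s = {i, j} \<and> A $ i $ j = of_real r)" for s
    have a: "A $ i $ j = of_real (a {i, j})" for i j
    proof -
      have real: "A $ i' $ j' \<in> \<real>" for i' j' using A by (auto simp: hermitian_def mat_over_def)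
      then have "\<exists>r. \<exists>i' j'. {i, j} = {i', j'} \<and> A $ i' $ j' = of_real r"
        by (metis Reals_cases)
      from someI_ex[OF this] obtain i' j' where
        *: "{i, j} = {i', j'}" "A $ i' $ j' = of_real (a {i, j})"
        by (auto simp: a_def)
      have "A $ j $ i = A $ i $ j"
        using hermitian_nth[OF A, of i j] real[of i j] by (simp add: Reals_cnj_iff)
      then show ?thesis using * by (auto simp: doubleton_eq_iff)
    qed
    have "A = (\<Sum>s\<in>U. a s *\<^sub>R M s)"
    proof (subst vec_eq_iff, intro allI, subst vec_eq_iff, intro allI)
      fix i j
      have "(\<Sum>s\<in>U. a s *\<^sub>R M s) $ i $ j = (\<Sum>s\<in>U. if s = {i, j} then of_real (a {i, j}) else 0)"
        unfolding sum_component by (intro sum.cong) (auto simp: M_def scaleR_complex)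
      also have "\<dots> = A $ i $ j"
        using pair by (simp add: a)
      finally show "A $ i $ j = (\<Sum>s\<in>U. a s *\<^sub>R M s) $ i $ j" by simp
    qed
    moreover have "(\<Sum>s\<in>U. a s *\<^sub>R M s) \<in> span (M ` U)"
      by (intro span_sum span_scale span_base) auto
    ultimately show "A \<in> span (M ` U)" by simp
  qed
  then have "dim (hermitian \<real> :: (complex ^ 'n ^ 'n) set) \<le> card (M ` U)"
    by (rule dim_le_card) simp
  also have "\<dots> \<le> card U" by (rule card_image_le) simp
  also have "card U = card {s :: 'n set. card s = 1} + card {s :: 'n set. card s = 2}"
    unfolding U_def by (rule card_Un_disjoint) auto
  also have "\<dots> = (CARD('n) choose 1) + (CARD('n) choose 2)"
    using n_subsets[of "UNIV :: 'n set" 1] n_subsets[of "UNIV :: 'n set" 2] by simp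
  also have "\<dots> = CARD('n) * (CARD('n) + 1) div 2"
    using choose_two[of "CARD('n) + 1"] by (simp add: numeral_2_eq_2 mult.commute)
  finally show ?thesis .
qed

lemma dim_hermitian:
  assumes "F = \<real> \<or> F = UNIV"
  shows "dim (hermitian F :: (complex ^ 'n ^ 'n) set) \<le> traceless_dim F CARD('n) + 1"
proof -
  have "\<i> \<notin> \<real>" by (simp add: complex_is_Real_iff)
  then have "(UNIV::complex set) \<noteq> \<real>" by blast
  moreover have "CARD('n) * (CARD('n) + 1) \<ge> 2"
    using mult_le_mono[of 1 "CARD('n)" 2 "CARD('n) + 1"] by (simp add: Suc_le_eq)
  ultimately show ?thesis
    using assms dim_hermitian_complex[where 'n='n] dim_hermitian_real[where 'n='n]
    by (auto simp: traceless_dim_def)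
qed

text \<open>
  Together with the identity matrix, which is orthogonal to everything traceless, the set becomes an
  independent set that is as large as the dimension of the Hermitian matrices permits; so it spans
  them.  In the expansion of a traceless matrix the coefficient of the identity is zero.
\<close>
lemma orthonormal_spans_traceless:
  fixes E :: "(complex ^ 'n ^ 'n) set"
  assumes F: "F = \<real> \<or> F = UNIV" and sub: "E \<subseteq> traceless_hermitian F"
    and fin: "finite E" and card: "card E = traceless_dim F CARD('n)"
    and on: "\<And>A C. A \<in> E \<Longrightarrow> C \<in> E \<Longrightarrow> trace (A ** C) = (if A = C then 1 else 0)"
  shows "span E = traceless_hermitian F"
proof
  let ?I = "mat 1 :: complex ^ 'n ^ 'n"
  have trI: "trace ?I = of_nat CARD('n)" by (rule trace_I)
  have I: "?I \<in> hermitian F" "?I \<noteq> 0"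
    using F trI by (auto simp: hermitian_def mat_over_def ctranspose_def mat_def vec_eq_iff)
  have sub': "E \<subseteq> hermitian F" using sub by (auto simp: traceless_hermitian_eq)
  have nI: "?I \<notin> E" using sub trI by (auto simp: traceless_hermitian_eq)
  have tr0: "trace A = 0" if "A \<in> E" for A using that sub by (auto simp: traceless_hermitian_eq)
  have "pairwise orthogonal (insert ?I E)"
    using on sub' I tr0
    by (auto simp: pairwise_insert pairwise_def orthogonal_def inner_eq_trace[of _ F])
  moreover have "0 \<notin> insert ?I E"
    using I on[of 0 0] by (auto simp: trace_def)
  ultimately have ind: "independent (insert ?I E)"
    by (rule pairwise_orthogonal_independent)
  have "hermitian F \<subseteq> span (insert ?I E)"
    using I sub' ind fin nI card dim_hermitian[OF F, where 'n='n]
    by (intro card_ge_dim_independent) auto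
  moreover have "A \<in> span E" if A: "A \<in> traceless_hermitian F" "A \<in> span (insert ?I E)" for A
  proof -
    obtain k where k: "A - k *\<^sub>R ?I \<in> span E"
      using A(2) by (auto simp: span_insert)
    moreover have "span E \<subseteq> traceless_hermitian F"
      using sub subspace_traceless_hermitian[OF F] by (rule span_minimal)
    ultimately have "trace (A - k *\<^sub>R ?I) = 0" by (auto simp: traceless_hermitian_eq)
    then have "of_real k * of_nat CARD('n) = (0::complex)"
      using A(1) trI by (simp add: trace_sub trace_scaleR traceless_hermitian_eq)
    then show ?thesis using k by simp
  qed
  ultimately show "traceless_hermitian F \<subseteq> span E"
    by (auto simp: traceless_hermitian_eq)
  show "span E \<subseteq> traceless_hermitian F"
    using sub subspace_traceless_hermitian[OF F] by (rule span_minimal)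
qed

section \<open>Hadamard 3-designs and orthoplectic fusion frames\<close>

lemma orthonormal_basis_cinner:
  fixes b :: "nat \<Rightarrow> complex ^ 'n"
  assumes "orthonormal_basis F b" "i \<in> {1..CARD('n)}" "j \<in> {1..CARD('n)}"
  shows "cinner (b i) (b j) = (if i = j then 1 else 0)"
  using assms unfolding orthonormal_basis_def by blast

lemma trace_coord_proj_mult_same_basis:
  fixes b :: "nat \<Rightarrow> complex ^ 'n"
  assumes b: "orthonormal_basis F b" and J: "J \<subseteq> {1..CARD('n)}" "J' \<subseteq> {1..CARD('n)}"
  shows "trace (coord_proj b J ** coord_proj b J') = of_real (real (card (J \<inter> J')))"
proof -
  have fin: "finite J" "finite J'" using J by (auto intro: finite_subset)
  have "trace (coord_proj b J ** coord_proj b J')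
      = (\<Sum>i\<in>J. \<Sum>j\<in>J'. of_real ((cmod (cinner (b i) (b j)))\<^sup>2))"
    unfolding coord_proj_def trace_mult_sum(1) unfolding trace_mult_sum(2) trace_outer_mult ..
  also have "\<dots> = (\<Sum>i\<in>J. \<Sum>j\<in>J'. if j = i then 1 else 0)"
    using b J by (intro sum.cong refl) (auto simp: orthonormal_basis_def subset_iff)
  also have "\<dots> = (\<Sum>i\<in>J. if i \<in> J' then 1 else 0)"
    using fin by simp
  also have "\<dots> = of_nat (card (J \<inter> J'))"
    using fin by (simp add: sum.If_cases Int_def)
  finally show ?thesis by simp
qed

text \<open>
  Each of the \<open>card J * card J'\<close> pairs of basis vectors contributes \<open>1 / m\<close>, whichever vectors are
  chosen: here unbiasedness enters.
\<close>
lemma trace_coord_proj_mult_unbiased: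
  fixes b b' :: "nat \<Rightarrow> complex ^ 'n"
  assumes u: "mutually_unbiased b b'" and J: "J \<subseteq> {1..CARD('n)}" "J' \<subseteq> {1..CARD('n)}"
  shows "trace (coord_proj b J ** coord_proj b' J') = of_real (real (card J) * real (card J') / real CARD('n))"
proof -
  have "trace (coord_proj b J ** coord_proj b' J')
      = (\<Sum>i\<in>J. \<Sum>j\<in>J'. of_real ((cmod (cinner (b i) (b' j)))\<^sup>2))"
    unfolding coord_proj_def trace_mult_sum(1) unfolding trace_mult_sum(2) trace_outer_mult ..
  also have "\<dots> = (\<Sum>i\<in>J. \<Sum>j\<in>J'. of_real (1 / real CARD('n)))"
    using u J unfolding mutually_unbiased_def by (intro sum.cong refl arg_cong[of _ _ of_real]) blast
  finally show ?thesis by simp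
qed

lemma trace_coord_proj:
  fixes b :: "nat \<Rightarrow> complex ^ 'n"
  assumes "orthonormal_basis F b" and "J \<subseteq> {1..CARD('n)}"
  shows "trace (coord_proj b J) = of_nat (card J)"
  unfolding coord_proj_def trace_sum trace_outer
  using assms by (subst sum.cong[of J J _ "\<lambda>_. 1"]) (auto simp: orthonormal_basis_def)

lemma rank_coord_proj_basis:
  fixes b :: "nat \<Rightarrow> complex ^ 'n"
  assumes "orthonormal_basis F b" and "J \<subseteq> {1..CARD('n)}"
  shows "rank (coord_proj b J) = card J"
proof (rule rank_coord_proj)
  show "finite J" using assms(2) by (auto intro: finite_subset)
  show "cinner (b i) (b j) = (if i = j then 1 else 0)" if "i \<in> J" "j \<in> J" for i j
    by (rule orthonormal_basis_cinner[OF assms(1)]) (use that assms(2) in blast)+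
qed

lemma orth_projection_coord_proj:
  fixes b :: "nat \<Rightarrow> complex ^ 'n"
  assumes F: "F = \<real> \<or> F = UNIV" and b: "orthonormal_basis F b" and J: "J \<subseteq> {1..CARD('n)}"
  shows "orth_projection F (coord_proj b J)"
  unfolding orth_projection_def
proof (intro conjI)
  have fin: "finite J" using J by (auto intro: finite_subset)
  have "b j $ i \<in> F" if "j \<in> J" for i j
    using that b J by (auto simp: orthonormal_basis_def vec_over_def)
  then show "coord_proj b J \<in> mat_over F"
    using F by (auto simp: mat_over_def coord_proj_def outer_def Reals_cnj_iff intro!: sum_in_Reals Reals_mult)
  show "ctranspose (coord_proj b J) = coord_proj b J"
    by (simp add: vec_eq_iff ctranspose_def coord_proj_def outer_def mult.commute)
  have "(coord_proj b J ** coord_proj b J) $ i $ k = coord_proj b J $ i $ k" for i k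
  proof -
    have "(coord_proj b J ** coord_proj b J) $ i $ k
        = (\<Sum>x\<in>UNIV. \<Sum>j\<in>J. \<Sum>j'\<in>J. b j $ i * cnj (b j $ x) * (b j' $ x * cnj (b j' $ k)))"
      by (simp add: matrix_matrix_mult_def coord_proj_def outer_def sum_product)
    also have "\<dots> = (\<Sum>j\<in>J. \<Sum>j'\<in>J. \<Sum>x\<in>UNIV. b j $ i * cnj (b j $ x) * (b j' $ x * cnj (b j' $ k)))"
      by (subst sum.swap, rule sum.cong[OF refl], rule sum.swap)
    also have "\<dots> = (\<Sum>j\<in>J. \<Sum>j'\<in>J. b j $ i * cnj (b j' $ k) * cinner (b j') (b j))"
      by (simp add: cinner_def sum_distrib_left mult_ac)
    also have "\<dots> = (\<Sum>j\<in>J. \<Sum>j'\<in>J. if j' = j then b j $ i * cnj (b j $ k) else 0)"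
      using b J by (intro sum.cong refl) (auto simp: orthonormal_basis_def subset_iff)
    also have "\<dots> = coord_proj b J $ i $ k"
      using fin by (simp add: coord_proj_def outer_def)
    finally show ?thesis .
  qed
  then show "coord_proj b J ** coord_proj b J = coord_proj b J"
    by (simp add: vec_eq_iff)
qed

lemma embed_traceless_hermitian:
  fixes P :: "complex ^ 'n ^ 'n"
  assumes F: "F = \<real> \<or> F = UNIV" and P: "orth_projection F P" and tr: "trace P = of_nat (rank P)"
  shows "embed P \<in> traceless_hermitian F"
proof -
  have sub: "subspace (hermitian F :: (complex ^ 'n ^ 'n) set)"
    by (rule subspace_hermitian[OF F])
  have "P \<in> hermitian F" "mat 1 \<in> (hermitian F :: (complex ^ 'n ^ 'n) set)"
    using P F by (auto simp: orth_projection_def hermitian_def mat_over_def ctranspose_def mat_def vec_eq_iff)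
  then have "embed P \<in> hermitian F"
    unfolding embed_def Let_def by (intro subspace_scale[OF sub] subspace_diff[OF sub])
  moreover have "trace (embed P) = 0"
    by (simp add: embed_def Let_def trace_scaleR trace_sub tr trace_I)
  ultimately show ?thesis by (simp add: traceless_hermitian_eq)
qed

text \<open>
  Subtracting the multiples of the identity lowers the inner product by \<open>l\<^sup>2 / m\<close>.  For \<open>l = 0\<close> and
  \<open>l = m\<close> both sides are zero by the conventions for division.
\<close>
lemma trace_embed_mult:
  fixes P Q :: "complex ^ 'n ^ 'n"
  assumes l: "rank P = l" "rank Q = l" "trace P = of_nat l" "trace Q = of_nat l" "l \<le> CARD('n)"
    and PQ: "trace (P ** Q) = of_real \<tau>"
  shows "trace (embed P ** embed Q)
       = of_real ((\<tau> - (real l)\<^sup>2 / real CARD('n)) / (real l * (real CARD('n) - real l) / real CARD('n)))"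
proof -
  define m where "m = real CARD('n)"
  have m: "m > 0" by (simp add: m_def)
  define r where "r = real l * (m - real l) / m"
  have r: "r \<ge> 0" using l(5) by (simp add: r_def m_def)
  define c a where "c = 1 / sqrt r" and "a = real l / m"
  have emb: "embed P = c *\<^sub>R (P - a *\<^sub>R mat 1)" "embed Q = c *\<^sub>R (Q - a *\<^sub>R mat 1)"
    by (simp_all only: embed_def Let_def l c_def a_def r_def m_def)
  have one: "trace (mat 1 ** A) = trace A" "trace (A ** mat 1) = trace A" for A :: "complex ^ 'n ^ 'n"
    by simp_all
  have I: "trace (mat 1 :: complex ^ 'n ^ 'n) = of_real m"
    by (simp add: trace_I m_def)
  have am: "a * m = real l" using m by (simp add: a_def)
  have "trace (embed P ** embed Q) = of_real (c * c * (\<tau> - a * real l - (a * real l - a * (a * m))))"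
    unfolding emb trace_mult_scaleR trace_mult_diff one trace_scaleR trace_sub PQ I l
    by (simp add: algebra_simps)
  also have "c * c * (\<tau> - a * real l - (a * real l - a * (a * m))) = (\<tau> - (real l)\<^sup>2 / m) / r"
    using r unfolding am by (simp add: c_def a_def power2_eq_square)
  finally show ?thesis by (simp add: r_def m_def)
qed

lemma trace_embed_same_basis:
  fixes b :: "nat \<Rightarrow> complex ^ 'n"
  assumes b: "orthonormal_basis F b" and J: "J \<subseteq> {1..CARD('n)}" "J' \<subseteq> {1..CARD('n)}"
    and l: "card J = l" "card J' = l"
  shows "trace (embed (coord_proj b J) ** embed (coord_proj b J'))
       = of_real ((real (card (J \<inter> J')) - (real l)\<^sup>2 / real CARD('n)) / (real l * (real CARD('n) - real l) / real CARD('n)))"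
proof (rule trace_embed_mult)
  show "l \<le> CARD('n)" using card_mono[OF _ J(1)] l by simp
qed (use assms in \<open>simp_all add: rank_coord_proj_basis trace_coord_proj trace_coord_proj_mult_same_basis\<close>)

lemma trace_embed_unbiased:
  fixes b b' :: "nat \<Rightarrow> complex ^ 'n"
  assumes b: "orthonormal_basis F b" "orthonormal_basis F b'" and u: "mutually_unbiased b b'"
    and J: "J \<subseteq> {1..CARD('n)}" "J' \<subseteq> {1..CARD('n)}" and l: "card J = l" "card J' = l"
  shows "trace (embed (coord_proj b J) ** embed (coord_proj b' J')) = 0"
proof -
  have "l \<le> CARD('n)" using card_mono[OF _ J(1)] l by simp
  moreover have "trace (coord_proj b J ** coord_proj b' J') = of_real ((real l)\<^sup>2 / real CARD('n))"
    using trace_coord_proj_mult_unbiased[OF u J] l by (simp add: power2_eq_square)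
  ultimately show ?thesis
    using trace_embed_mult[of "coord_proj b J" l "coord_proj b' J'" "(real l)\<^sup>2 / real CARD('n)"] assms
    by (simp add: rank_coord_proj_basis[of F] trace_coord_proj[of F])
qed

text \<open>
  The bound on the number of bases is the number for which \<open>m - 1\<close> independent vectors from each basis
  fill the traceless matrices.
\<close>
lemma traceless_dim_eq_mub_bound:
  assumes "m \<ge> 1"
  shows "real (traceless_dim F m) = mub_bound F m * (real m - 1)"
proof (cases "F = \<real>")
  case True
  have "m * (m + 1) \<ge> 2" using mult_le_mono[of 1 m 2 "m + 1"] assms by simp
  then have "real (traceless_dim F m) = real (m * (m + 1) div 2) - 1"
    using True by (simp add: traceless_dim_def of_nat_diff)
  also have "real (m * (m + 1) div 2) = real (m * (m + 1)) / 2"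
    by (subst real_of_nat_div) simp_all
  finally show ?thesis using True by (simp add: mub_bound_def field_simps)
next
  case False
  then show ?thesis
    using assms by (simp add: traceless_dim_def mub_bound_def of_nat_diff power2_eq_square field_simps)
qed

text \<open>
  This is the equality case of the Cauchy-Schwarz inequality: \<open>A + C\<close> has norm zero.
\<close>
lemma uminus_eq_of_trace:
  assumes "A \<in> hermitian F" "C \<in> hermitian F" and "trace (A ** A) = 1" "trace (C ** C) = 1"
    and "trace (A ** C) = - 1"
  shows "C = - A"
proof -
  have "inner (A + C) (A + C) = 0"
    using assms by (simp add: inner_add_left inner_add_right inner_commute[of C A] inner_eq_trace[of _ F])
  then show ?thesis by (simp add: add_eq_0_iff)
qed

text \<open>
  The blocks are indexed by rows \<open>i\<close> and signs \<open>s\<close>.  Inner products of embedded vectors are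
  \<open>s * s'\<close> for equal bases and rows and \<open>0\<close> otherwise, so the vectors with \<open>s = 1\<close> form an
  orthonormal set \<open>E\<close>, of the size that makes it a basis, and those with \<open>s = - 1\<close> are its negatives.
\<close>
lemma hadamard_imp_frame:
  fixes B :: "'k \<Rightarrow> nat \<Rightarrow> complex ^ 'n"
  assumes F: "F = \<real> \<or> F = UNIV" and mub: "maximal_mub_family F K B"
    and S: "hadamard_3_design CARD('n) S"
  shows "max_orthoplectic_ff F (mub_projections K B S) \<and> constant_rank (mub_projections K B S)"
proof -
  obtain t H where t: "t \<ge> 1" "CARD('n) = 4 * t" and H0: "hadamard_matrix (4 * t) H"
    "\<forall>j\<in>{1..4 * t}. H (4 * t) j = 1"
    and S0: "S = (\<Union>i\<in>{1..4 * t - 1}. {{j \<in> {1..4 * t}. H i j = 1}, {j \<in> {1..4 * t}. H i j = - 1}})"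
    using S unfolding hadamard_3_design_def by blast
  define m where "m = CARD('n)"
  have m4: "m = 4 * t" "m > 0" using t by (simp_all add: m_def)
  note H = H0[folded m4(1)]
  define W where "W = sign_block m H"
  define sgns where "sgns = {1, - 1 :: int}"
  define R where "R = {1..m - 1}"
  have S_eq: "S = (\<lambda>(i, s). W i s) ` (R \<times> sgns)"
    unfolding S0 m4(1)[symmetric] W_def R_def sgns_def by (rule hadamard_blocks_eq)
  have fam: "mub_family F K B" and finK: "finite K" and cardK: "real (card K) = mub_bound F m"
    using mub by (auto simp: maximal_mub_family_def m_def)
  have onb: "orthonormal_basis F (B k)" if "k \<in> K" for k
    using that fam by (auto simp: mub_family_def)
  have W: "W i s \<subseteq> {1..CARD('n)}" for i s
    by (auto simp: W_def sign_block_def m_def)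
  have cardW: "card (W i s) = 2 * t" if "i \<in> R" "s \<in> sgns" for i s
    using card_sign_block[OF H] that m4 by (simp add: W_def R_def sgns_def)
  define Pr where "Pr k i s = coord_proj (B k) (W i s)" for k i s
  define v where "v k i s = embed (Pr k i s)" for k i s
  have same: "trace (v k i s ** v k i' s') = of_real ((real (card (W i s \<inter> W i' s')) - t) / t)"
    if "k \<in> K" "i \<in> R" "i' \<in> R" "s \<in> sgns" "s' \<in> sgns" for k i i' s s'
    unfolding v_def Pr_def trace_embed_same_basis[OF onb[OF that(1)] W W cardW[OF that(2,4)] cardW[OF that(3,5)]]
    using t by (simp add: power2_eq_square)
  have tr_v: "trace (v k i s ** v k' i' s') = (if k = k' \<and> i = i' then of_int (s * s') else 0)"
    if "k \<in> K" "k' \<in> K" "i \<in> R" "i' \<in> R" "s \<in> sgns" "s' \<in> sgns" for k k' i i' s s'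
  proof (cases "k = k'")
    case False
    then have "mutually_unbiased (B k) (B k')" using fam that by (auto simp: mub_family_def)
    then show ?thesis
      using trace_embed_unbiased[OF onb[OF that(1)] onb[OF that(2)] _ W W cardW[OF that(3,5)] cardW[OF that(4,6)]] False
      by (simp add: v_def Pr_def)
  next
    case True
    show ?thesis
    proof (cases "i = i'")
      case False
      have "4 * card (W i s \<inter> W i' s') = m"
        unfolding W_def using that False by (intro card_sign_block_Int[OF H]) (auto simp: R_def sgns_def)
      then show ?thesis using same[of k i i' s s'] that True False m4 by simp
    next
      case eq: True
      have "W i s \<inter> W i s' = (if s = s' then W i s else {})"
        by (auto simp: W_def sign_block_def)
      then show ?thesis
        using same[of k i i' s s'] that True eq t cardW[of i s] by (auto simp: sgns_def)
    qed
  qed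
  have v_mem: "v k i s \<in> traceless_hermitian F" if "k \<in> K" for k i s
    unfolding v_def Pr_def using onb[OF that] W
    by (intro embed_traceless_hermitian[OF F])
       (simp_all add: orth_projection_coord_proj[OF F] trace_coord_proj rank_coord_proj_basis)
  have sg1: "1 \<in> sgns" "- 1 \<in> sgns" by (simp_all add: sgns_def)
  \<comment> \<open>Complementary blocks give antipodal vectors, as their inner product is \<open>- 1\<close>.\<close>
  have neg: "v k i (- 1) = - v k i 1" if "k \<in> K" "i \<in> R" for k i
    by (rule uminus_eq_of_trace[of _ F])
       (use that v_mem sg1 tr_v in \<open>auto simp: traceless_hermitian_eq\<close>)
  define Z where "Z = K \<times> R \<times> sgns"
  have P_eq: "mub_projections K B S = (\<lambda>(k, i, s). Pr k i s) ` Z"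
    by (auto simp: mub_projections_def S_eq Z_def Pr_def image_iff) blast+
  have inj_v: "inj_on (\<lambda>(k, i, s). v k i s) Z"
  proof (rule inj_onI)
    fix x y assume z: "x \<in> Z" "y \<in> Z"
      and eq: "(\<lambda>(k, i, s). v k i s) x = (\<lambda>(k, i, s). v k i s) y"
    obtain k i s k' i' s' where xy: "x = (k, i, s)" "y = (k', i', s')"
      by (cases x, cases y) auto
    have "trace (v k i s ** v k' i' s') = trace (v k i s ** v k i s)" using eq xy by simp
    then show "x = y"
      using z xy tr_v by (auto simp: Z_def sgns_def split: if_splits)
  qed
  have "(\<lambda>(k, i, s). v k i s) = embed \<circ> (\<lambda>(k, i, s). Pr k i s)"
    by (auto simp: fun_eq_iff v_def)
  with inj_v have inj_P: "inj_on (\<lambda>(k, i, s). Pr k i s) Z"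
    by (metis inj_on_imageI2)
  have dim: "card K * (m - 1) = traceless_dim F m"
  proof -
    have "real (card K * (m - 1)) = real (traceless_dim F m)"
      using traceless_dim_eq_mub_bound[of m F] cardK m4 by (simp add: of_nat_diff)
    then show ?thesis by linarith
  qed
  have card_P: "card (mub_projections K B S) = 2 * traceless_dim F m"
  proof -
    have "card (mub_projections K B S) = card Z"
      unfolding P_eq by (rule card_image[OF inj_P])
    also have "\<dots> = 2 * (card K * (m - 1))"
      by (simp add: Z_def card_cartesian_product R_def sgns_def)
    finally show ?thesis using dim by simp
  qed
  define E where "E = (\<lambda>(k, i). v k i 1) ` (K \<times> R)"
  have inj_E: "inj_on (\<lambda>(k, i). v k i 1) (K \<times> R)"
    using inj_v sg1 by (auto simp: inj_on_def Z_def)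
  have on: "trace (A ** C) = (if A = C then 1 else 0)" if AC: "A \<in> E" "C \<in> E" for A C
  proof -
    obtain k i k' i' where *: "k \<in> K" "i \<in> R" "k' \<in> K" "i' \<in> R" "A = v k i 1" "C = v k' i' 1"
      using AC by (auto simp: E_def)
    then have "A = C \<longleftrightarrow> k = k' \<and> i = i'"
      using inj_onD[OF inj_E, of "(k, i)" "(k', i')"] by auto
    then show ?thesis using tr_v[of k k' i i' 1 1] sg1 * by simp
  qed
  have "span E = traceless_hermitian F"
  proof (rule orthonormal_spans_traceless[OF F _ _ _ on])
    show "E \<subseteq> traceless_hermitian F" using v_mem by (auto simp: E_def)
    show "finite E" using finK by (simp add: E_def R_def)
    show "card E = traceless_dim F CARD('n)"
      proof -
      have "card E = card (K \<times> R)"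
        unfolding E_def by (rule card_image[OF inj_E])
      then show ?thesis using dim by (simp add: card_cartesian_product R_def m_def)
    qed
  qed
  then have "onb_of (traceless_hermitian F) E"
    using v_mem on by (auto simp: onb_of_def E_def)
  moreover have "embed ` mub_projections K B S = E \<union> uminus ` E"
  proof -
    have "embed ` mub_projections K B S = (\<lambda>(k, i, s). v k i s) ` Z"
      unfolding P_eq image_image by (intro image_cong) (auto simp: v_def)
    also have "\<dots> = E \<union> uminus ` E"
      using neg by (force simp: Z_def E_def sgns_def image_iff)
    finally show ?thesis .
  qed
  ultimately have "orthoplex_of (traceless_hermitian F) (embed ` mub_projections K B S)"
    unfolding orthoplex_of_def by blast
  moreover have "\<forall>P\<in>mub_projections K B S. orth_projection F P"
    unfolding P_eq Pr_def Z_def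
    using orth_projection_coord_proj[OF F onb W] by (auto simp del: One_nat_def)
  moreover have "\<forall>P\<in>mub_projections K B S. rank P = 2 * t"
    unfolding P_eq Pr_def Z_def
    using rank_coord_proj_basis[OF onb W] cardW by (auto simp del: One_nat_def)
  ultimately show ?thesis
    using card_P by (auto simp: max_orthoplectic_ff_def constant_rank_def m_def)
qed

text \<open>
  The size of the frame determines the number of blocks.  The antipode of each vector determines
  the block size and closure under complements.  The remaining inner products determine how blocks
  meet.
\<close>
lemma frame_imp_hadamard:
  fixes B :: "'k \<Rightarrow> nat \<Rightarrow> complex ^ 'n"
  assumes F: "F = \<real> \<or> F = UNIV" and mub: "maximal_mub_family F K B"
    and blocks: "\<forall>J\<in>S. J \<subseteq> {1..CARD('n)} \<and> card J = l" and gt: "CARD('n) > 2"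
    and frame: "max_orthoplectic_ff F (mub_projections K B S)"
  shows "hadamard_3_design CARD('n) S"
proof -
  define m where "m = CARD('n)"
  have m: "m > 2" "real m > 0" using gt by (simp_all add: m_def)
  have fam: "mub_family F K B" and finK: "finite K" and cardK: "real (card K) = mub_bound F m"
    using mub by (auto simp: maximal_mub_family_def m_def)
  have onb: "orthonormal_basis F (B k)" if "k \<in> K" for k
    using that fam by (auto simp: mub_family_def)
  have J: "J \<subseteq> {1..CARD('n)}" "J \<subseteq> {1..m}" "card J = l" "finite J" if "J \<in> S" for J
    using that blocks by (auto simp: m_def intro: finite_subset)
  have finS: "finite S"
    by (rule finite_subset[of _ "Pow {1..m}"]) (use J in auto)
  define v where "v k J = embed (coord_proj (B k) J)" for k J
  define r where "r = real l * (real m - real l) / real m"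
  have same: "trace (v k J ** v k J') = of_real ((real (card (J \<inter> J')) - (real l)\<^sup>2 / real m) / r)"
    if "k \<in> K" "J \<in> S" "J' \<in> S" for k J J'
    unfolding v_def r_def m_def by (rule trace_embed_same_basis[OF onb[OF that(1)]]) (use J that in auto)
  have diff: "trace (v k J ** v k' J') = 0" if "k \<in> K" "k' \<in> K" "k \<noteq> k'" "J \<in> S" "J' \<in> S" for k k' J J'
  proof -
    have "mutually_unbiased (B k) (B k')" using fam that by (auto simp: mub_family_def)
    then show ?thesis
      unfolding v_def by (rule trace_embed_unbiased[OF onb[OF that(1)] onb[OF that(2)], where l = l]) (use J that in auto)
  qed
  define d where "d = traceless_dim F m"
  have d: "real d = real (card K) * (real m - 1)"
    using traceless_dim_eq_mub_bound[of m F] m cardK by (simp add: d_def)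
  have K_pos: "card K > 0"
    using cardK m(2) by (simp add: mub_bound_def split: if_splits)
  have card_P: "card (mub_projections K B S) = 2 * d"
    using frame by (simp add: max_orthoplectic_ff_def d_def m_def)
  obtain E where E: "onb_of (traceless_hermitian F) E" "embed ` mub_projections K B S = E \<union> uminus ` E"
    using frame by (auto simp: max_orthoplectic_ff_def orthoplex_of_def)
  have P_eq: "mub_projections K B S = (\<lambda>(k, J). coord_proj (B k) J) ` (K \<times> S)"
    by (auto simp: mub_projections_def)
  define Q where "Q = (\<lambda>(k, J). v k J) ` (K \<times> S)"
  have Q: "Q = E \<union> uminus ` E"
    unfolding E(2)[symmetric] P_eq Q_def v_def image_image by (intro image_cong) auto
  have v_mem: "v k J \<in> Q" if "k \<in> K" "J \<in> S" for k J
    using that by (auto simp: Q_def intro!: image_eqI[of _ _ "(k, J)"])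
  have on: "trace (A ** C) = (if A = C then 1 else 0)" if "A \<in> E" "C \<in> E" for A C
    using E(1) that by (auto simp: onb_of_def)
  have Q_unit: "trace (A ** A) = 1" if "A \<in> Q" for A
    using that on by (auto simp: Q trace_mult_uminus)
  have Q_prod: "trace (A ** C) \<in> {0, 1, - 1}" if "A \<in> Q" "C \<in> Q" for A C
    using that on by (auto simp: Q trace_mult_uminus split: if_splits)
  have Q_neg: "- A \<in> Q" if "A \<in> Q" for A
    using that by (auto simp: Q)
  have "d > 0"
  proof -
    have "real d > 0" using d K_pos m by simp
    then show ?thesis by simp
  qed
  then have "card (K \<times> S) > 0"
    using card_P[unfolded P_eq] finite_cartesian_product[OF finK finS]
      card_image_le[of "K \<times> S" "\<lambda>(k, J). coord_proj (B k) J"] by linarith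
  then obtain k0 J0 where k0: "k0 \<in> K" and J0: "J0 \<in> S" by (auto simp: card_gt_0_iff)
  have lm: "l \<le> m" using card_mono[OF _ J(2)[OF J0]] J(3)[OF J0] by simp
  have r0: "r \<noteq> 0"
    using Q_unit[OF v_mem[OF k0 J0]] same[OF k0 J0 J0] by auto
  then have l: "0 < l" "l < m"
    using lm by (auto simp: r_def intro: le_neq_implies_less)
  \<comment> \<open>Equal vectors have inner product \<open>1\<close>, which occurs only for equal bases and blocks.\<close>
  have inj: "inj_on (\<lambda>(k, J). v k J) (K \<times> S)"
  proof (rule inj_onI, clarify)
    fix k J1 k' J2 assume *: "k \<in> K" "J1 \<in> S" "k' \<in> K" "J2 \<in> S" "v k J1 = v k' J2"
    then have tr1: "trace (v k J1 ** v k' J2) = 1" using Q_unit v_mem by metis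
    then have "k = k'" using diff * by force
    have "(real (card (J1 \<inter> J2)) - (real l)\<^sup>2 / real m) / r = 1"
      using tr1 same[of k J1 J2] * \<open>k = k'\<close> by (metis of_real_eq_1_iff)
    then have "real (card (J1 \<inter> J2)) - (real l)\<^sup>2 / real m = r"
      using r0 by simp
    moreover have "r = real l - (real l)\<^sup>2 / real m"
      using m(2) by (simp add: r_def field_simps power2_eq_square)
    ultimately have "card (J1 \<inter> J2) = l" by simp
    then have "J1 \<inter> J2 = J1" "J1 \<inter> J2 = J2"
      using card_subset_eq[of J1 "J1 \<inter> J2"] card_subset_eq[of J2 "J1 \<inter> J2"] J * by auto
    then show "k = k' \<and> J1 = J2" using \<open>k = k'\<close> by auto
  qed
  have "(\<lambda>(k, J). v k J) = embed \<circ> (\<lambda>(k, J). coord_proj (B k) J)"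
    by (auto simp: fun_eq_iff v_def)
  with inj have inj_P: "inj_on (\<lambda>(k, J). coord_proj (B k) J) (K \<times> S)"
    by (metis inj_on_imageI2)
  have "card K * card S = 2 * d"
    using card_P card_image[OF inj_P] by (simp add: P_eq card_cartesian_product)
  then have "real (card K) * real (card S) = real (card K) * (2 * (real m - 1))"
    using d by (metis mult.left_commute of_nat_mult of_nat_numeral)
  then have card_S: "real (card S) = 2 * (real m - 1)"
    using K_pos by simp

  have neg: "\<exists>J'\<in>S. v k J' = - v k J" if "k \<in> K" "J \<in> S" for k J
  proof -
    have "- v k J \<in> Q" using Q_neg v_mem that by blast
    then obtain k' J' where *: "k' \<in> K" "J' \<in> S" "v k' J' = - v k J" by (auto simp: Q_def)
    then have "trace (v k J ** v k' J') = - 1"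
      using Q_unit[OF v_mem[OF that]] by (simp add: trace_mult_uminus)
    then have "k = k'" using diff[of k k' J J'] * that by fastforce
    then show ?thesis using * by blast
  qed
  \<comment> \<open>The diagonal entries of an embedded vector in its own basis.\<close>
  have trace_point: "trace (v k J ** coord_proj (B k) {j}) = of_real ((of_bool (j \<in> J) - real l / real m) / sqrt r)"
    if "k \<in> K" "J \<in> S" "j \<in> {1..m}" for k J j
  proof -
    have "trace (coord_proj (B k) J ** coord_proj (B k) {j}) = of_real (of_bool (j \<in> J))"
      using trace_coord_proj_mult_same_basis[OF onb[OF that(1)] J(1)[OF that(2)], of "{j}"] that
      by (auto simp: m_def)
    moreover have "trace (coord_proj (B k) {j}) = 1"
      using trace_coord_proj[OF onb[OF that(1)], of "{j}"] that by (simp add: m_def)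
    moreover have "rank (coord_proj (B k) J) = l"
      using rank_coord_proj_basis[OF onb[OF that(1)] J(1)[OF that(2)]] J(3)[OF that(2)] by simp
    moreover have "v k J = (1 / sqrt r) *\<^sub>R (coord_proj (B k) J - (real l / real m) *\<^sub>R mat 1)"
      using calculation(3) by (simp only: v_def embed_def Let_def r_def m_def)
    ultimately show ?thesis
      by (simp add: trace_mult_scaleR trace_mult_diff)
  qed
  have compl: "2 * l = m \<and> {1..m} - J \<in> S" if JS: "J \<in> S" for J
  proof -
    obtain J' where J': "J' \<in> S" "v k0 J' = - v k0 J" using neg[OF k0 JS] by blast
    have sr: "sqrt r \<noteq> 0" using r0 by simp
    \<comment> \<open>The two diagonals are opposite, so the two indicators add up to a constant.\<close>
    have bal: "of_bool (j \<in> J') + of_bool (j \<in> J) = 2 * real l / real m" if "j \<in> {1..m}" for j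
    proof -
      have "(of_bool (j \<in> J') - real l / real m) / sqrt r = - ((of_bool (j \<in> J) - real l / real m) / sqrt r)"
        using trace_point[OF k0 J'(1) that] trace_point[OF k0 JS that]
        unfolding J'(2) trace_mult_uminus by (metis of_real_eq_iff of_real_minus)
      then have "of_bool (j \<in> J') - real l / real m = - (of_bool (j \<in> J) - real l / real m)"
        using sr by (simp only: minus_divide_left divide_cancel_right) simp
      then show ?thesis by simp
    qed
    \<comment> \<open>A point of \<open>J\<close> makes the constant at least \<open>1\<close> and a point outside makes it at most \<open>1\<close>.\<close>
    have "J \<noteq> {}" using J(3)[OF JS] l by auto
    then obtain j0 where j0: "j0 \<in> J" by blast
    have "J \<noteq> {1..m}" using J(3)[OF JS] l by auto
    then obtain j1 where j1: "j1 \<in> {1..m}" "j1 \<notin> J" using J(2)[OF JS] by blast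
    have "of_bool (j0 \<in> J') + 1 = 2 * real l / real m" "of_bool (j1 \<in> J') = 2 * real l / real m"
      using bal[of j0] bal[of j1] j0 j1 J(2)[OF JS] by auto
    then have half: "2 * real l / real m = 1"
      by (auto simp: of_bool_def split: if_splits)
    then have "2 * real l = real m" using m(2) by (simp add: divide_eq_1_iff)
    then have "2 * l = m" by linarith
    moreover have "j \<in> J' \<longleftrightarrow> j \<notin> J" if "j \<in> {1..m}" for j
      using bal[OF that] unfolding half by (auto simp: of_bool_def split: if_splits)
    then have "J' = {1..m} - J" using J(2)[OF J'(1)] by blast
    ultimately show ?thesis using J'(1) by simp
  qed
  have half: "2 * l = m" using compl[OF J0] by simp
  have r_eq: "r = real m / 4" "(real l)\<^sup>2 / real m = real m / 4"
  proof -
    have "real m = 2 * real l" using half by simp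
    then show "r = real m / 4" "(real l)\<^sup>2 / real m = real m / 4"
      using l by (simp_all add: r_def power2_eq_square)
  qed
  have quarter: "4 * card (J1 \<inter> J2) = m" if "J1 \<in> S" "J2 \<in> S" "J1 \<noteq> J2" "J1 \<inter> J2 \<noteq> {}" for J1 J2
  proof -
    define q where "q = (real (card (J1 \<inter> J2)) - real m / 4) / (real m / 4)"
    have "complex_of_real q \<in> {0, 1, - 1}"
      using Q_prod[OF v_mem[OF k0 that(1)] v_mem[OF k0 that(2)]]
      unfolding same[OF k0 that(1,2)] r_eq q_def .
    then have "q \<in> {0, 1, - 1}" by (auto simp: complex_eq_iff)
    moreover have "card (J1 \<inter> J2) \<noteq> 0" using that J by auto
    moreover have "card (J1 \<inter> J2) \<noteq> l"
    proof
      assume "card (J1 \<inter> J2) = l"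
      then have "J1 \<inter> J2 = J1" "J1 \<inter> J2 = J2"
        using card_subset_eq[of J1 "J1 \<inter> J2"] card_subset_eq[of J2 "J1 \<inter> J2"] J that by auto
      then show False using that by auto
    qed
    moreover have "real (card (J1 \<inter> J2)) = (1 + q) * (real m / 4)"
      using m by (simp add: q_def field_simps)
    moreover have "real m = 2 * real l" using half by simp
    ultimately show ?thesis by auto
  qed

  \<comment> \<open>Choosing the members through the point \<open>m\<close> picks one block of each complementary pair, and no two
    of the chosen blocks are disjoint.\<close>
  define S0 where "S0 = {J \<in> S. m \<in> J}"
  have S_split: "S = S0 \<union> (\<lambda>J. {1..m} - J) ` S0"
  proof
    show "S \<subseteq> S0 \<union> (\<lambda>J. {1..m} - J) ` S0"
    proof
      fix J assume JS: "J \<in> S"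
      show "J \<in> S0 \<union> (\<lambda>J. {1..m} - J) ` S0"
      proof (cases "m \<in> J")
        case False
        then have "{1..m} - J \<in> S0" using compl[OF JS] m by (simp add: S0_def)
        moreover have "J = {1..m} - ({1..m} - J)" using J(2)[OF JS] by auto
        ultimately show ?thesis by blast
      qed (use JS in \<open>simp add: S0_def\<close>)
    qed
  qed (use compl in \<open>auto simp: S0_def\<close>)
  have card_S0: "card S0 = m - 1"
  proof -
    have "inj_on (\<lambda>J. {1..m} - J) S0"
      by (rule inj_onI) (use J in \<open>auto simp: S0_def, blast+\<close>)
    moreover have "S0 \<inter> (\<lambda>J. {1..m} - J) ` S0 = {}" by (auto simp: S0_def)
    moreover have "finite S0" using finS by (simp add: S0_def)
    ultimately have "card S = 2 * card S0"
      by (subst S_split) (simp add: card_Un_disjoint card_image)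
    then show ?thesis using card_S m by (simp add: of_nat_diff)
  qed
  have quarter0: "4 * card (J1 \<inter> J2) = m" if "J1 \<in> S0" "J2 \<in> S0" "J1 \<noteq> J2" for J1 J2
    using that by (intro quarter) (auto simp: S0_def)
  obtain h where h: "bij_betw h {1..m - 1} S0"
    using ex_bij_betw_nat_finite_1[of S0] finS card_S0 by (auto simp: S0_def)
  have h_mem: "h i \<in> S0" if "i \<in> {1..m - 1}" for i
    using h that by (auto simp: bij_betw_def)
  have h_neq: "h i \<noteq> h i'" if "i \<in> {1..m - 1}" "i' \<in> {1..m - 1}" "i \<noteq> i'" for i i'
    using h that by (auto simp: bij_betw_def inj_on_def)
  obtain t where t: "m = 4 * t"
  proof -
    have "1 \<in> {1..m - 1}" "2 \<in> {1..m - 1}" using m by auto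
    from quarter0[OF h_mem[OF this(1)] h_mem[OF this(2)] h_neq[OF this]]
    have "m = 4 * card (h 1 \<inter> h 2)" by simp
    then show ?thesis by (rule that)
  qed
  define H :: "nat \<Rightarrow> nat \<Rightarrow> int" where "H i j = (if i = m \<or> j \<in> h i then 1 else - 1)" for i j
  have sum_H: "(\<Sum>j=1..m. H i j) = 0" if "i \<in> {1..m - 1}" for i
  proof -
    have hi: "h i \<in> S" using h_mem[OF that] by (simp add: S0_def)
    have "(\<Sum>j=1..m. H i j) = (\<Sum>j=1..m. 2 * of_bool (j \<in> h i) - 1)"
      using that by (intro sum.cong) (auto simp: H_def)
    also have "\<dots> = 2 * int (card ({1..m} \<inter> h i)) - int m"
      by (simp add: sum_subtractf flip: sum_distrib_left)
    also have "{1..m} \<inter> h i = h i" using J(2)[OF hi] by auto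
    finally show ?thesis using J(3)[OF hi] half by simp
  qed
  have "(\<Sum>j=1..m. H i j * H i' j) = 0" if "i \<in> {1..m}" "i' \<in> {1..m}" "i \<noteq> i'" for i i'
  proof -
    have "i = m \<or> i' = m \<or> (i \<in> {1..m - 1} \<and> i' \<in> {1..m - 1})" using that by auto
    then consider "i = m" | "i' = m" | "i \<in> {1..m - 1}" "i' \<in> {1..m - 1}" by blast
    then show ?thesis
    proof cases
      case 1
      then have "(\<Sum>j=1..m. H i j * H i' j) = (\<Sum>j=1..m. H i' j)" by (simp add: H_def)
      then show ?thesis using sum_H[of i'] that 1 by auto
    next
      case 2
      then have "(\<Sum>j=1..m. H i j * H i' j) = (\<Sum>j=1..m. H i j)" by (simp add: H_def)
      then show ?thesis using sum_H[of i] that 2 by auto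
    next
      case 3
      have hi: "h i \<in> S" "h i' \<in> S" using h_mem 3 by (auto simp: S0_def)
      have "(\<Sum>j=1..m. H i j * H i' j) = (\<Sum>j=1..m. 4 * of_bool (j \<in> h i \<inter> h i') - H i j - H i' j - 1)"
        using 3 by (intro sum.cong) (auto simp: H_def)
      also have "\<dots> = 4 * int (card ({1..m} \<inter> (h i \<inter> h i'))) - int m"
        using sum_H 3 by (simp add: sum_subtractf Int_def flip: sum_distrib_left)
      also have "{1..m} \<inter> (h i \<inter> h i') = h i \<inter> h i'" using J(2)[OF hi(1)] by auto
      finally show ?thesis
        using quarter0[OF h_mem[OF 3(1)] h_mem[OF 3(2)] h_neq[OF 3 that(3)]] by simp
    qed
  qed
  then have had: "hadamard_matrix m H"
    by (auto simp: hadamard_matrix_def H_def)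
  have "hadamard_3_design m (\<Union>i\<in>{1..m - 1}. {{j \<in> {1..m}. H i j = 1}, {j \<in> {1..m}. H i j = - 1}})"
    using hadamard_matrix_imp_3_design[of t H] had t m by (simp add: H_def)
  also have "(\<Union>i\<in>{1..m - 1}. {{j \<in> {1..m}. H i j = 1}, {j \<in> {1..m}. H i j = - 1}}) = S"
  proof -
    have "{j \<in> {1..m}. H i j = 1} = h i" "{j \<in> {1..m}. H i j = - 1} = {1..m} - h i" if "i \<in> {1..m - 1}" for i
      using that J(2)[of "h i"] h_mem[OF that] by (auto simp: H_def S0_def split: if_splits)
    then have "(\<Union>i\<in>{1..m - 1}. {{j \<in> {1..m}. H i j = 1}, {j \<in> {1..m}. H i j = - 1}})
        = (\<Union>i\<in>{1..m - 1}. {h i, {1..m} - h i})" by (intro SUP_cong refl) simp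
    also have "\<dots> = h ` {1..m - 1} \<union> (\<lambda>J. {1..m} - J) ` h ` {1..m - 1}" by auto
    also have "\<dots> = S" using h S_split by (simp add: bij_betw_def)
    finally show ?thesis .
  qed
  finally show ?thesis by (simp add: m_def)
qed

section \<open>Finite fields of characteristic two\<close>

type_synonym f2bar = "bit alg_closure"

lemma char_f2bar: "CHAR(f2bar) = 2"
proof -
  have "CHAR(bit) = 2"
  proof (rule CHAR_eqI)
    show "of_nat 2 = (0::bit)" by simp
    show "2 dvd n" if "of_nat n = (0::bit)" for n
      using that by (metis even_of_nat bit_2_eq_0 dvd_0_right)
  qed
  then show ?thesis by simp
qed

lemma f2bar_double [simp]: "(x::f2bar) + x = 0"
proof -
  have "x + x = of_nat 2 * x" by simp
  also have "(of_nat 2 :: f2bar) = 0"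
    using char_f2bar by (metis of_nat_CHAR)
  finally show ?thesis by simp
qed

lemma f2bar_2 [simp]: "(2::f2bar) = 0"
  by (metis f2bar_double one_add_one)

lemma f2bar_uminus: "- (x::f2bar) = x"
  by (metis add_eq_0_iff f2bar_double)

lemma f2bar_diff: "(x::f2bar) - y = x + y"
  by (metis diff_conv_add_uminus f2bar_uminus)

lemma f2bar_add_eq_0_iff: "(x::f2bar) + y = 0 \<longleftrightarrow> x = y"
  by (metis add_eq_0_iff f2bar_uminus)

lemma frobenius_add: "((x::f2bar) + y) ^ 2 ^ k = x ^ 2 ^ k + y ^ 2 ^ k"
  by (rule freshmans_dream') (simp_all add: char_f2bar del: CHAR_alg_closure)

lemma frobenius_sum: "(sum f A :: f2bar) ^ 2 = (\<Sum>a\<in>A. f a ^ 2)"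
  by (rule freshmans_dream_sum) (simp_all add: char_f2bar del: CHAR_alg_closure)

text \<open>
  For \<open>N \<ge> 1\<close>, the field with \<open>2\<^sup>N\<close> elements, as the set of fixed points of the \<open>N\<close>-th power of the Frobenius map.
\<close>
definition gf2 :: "nat \<Rightarrow> f2bar set" where
  "gf2 N = {x. x ^ 2 ^ N = x}"

lemma gf2_0 [simp]: "0 \<in> gf2 N" and gf2_1 [simp]: "1 \<in> gf2 N"
  by (simp_all add: gf2_def)

lemma gf2_add: "x \<in> gf2 N \<Longrightarrow> y \<in> gf2 N \<Longrightarrow> x + y \<in> gf2 N"
  by (simp add: gf2_def frobenius_add)

lemma gf2_mult: "x \<in> gf2 N \<Longrightarrow> y \<in> gf2 N \<Longrightarrow> x * y \<in> gf2 N"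
  by (simp add: gf2_def power_mult_distrib)

lemma gf2_divide: "x \<in> gf2 N \<Longrightarrow> y \<in> gf2 N \<Longrightarrow> x / y \<in> gf2 N"
  by (simp add: gf2_def power_divide)

text \<open>
  Over an algebraically closed field a polynomial has as many roots as its degree, counted with
  multiplicity, and a multiple root would also be a root of the derivative.
\<close>
lemma card_roots_coprime_pderiv:
  fixes p :: "'a :: alg_closed_field poly"
  assumes "\<And>x. poly p x = 0 \<Longrightarrow> poly (pderiv p) x \<noteq> 0"
  shows "card {x. poly p x = 0} = Polynomial.degree p"
proof (cases "p = 0")
  case False
  then obtain A where A: "size A = Polynomial.degree p" "p = Polynomial.smult (Polynomial.lead_coeff p) (\<Prod>x\<in>#A. [:-x, 1:])"
    using alg_closed_imp_factorization by blast
  have lc: "Polynomial.lead_coeff p \<noteq> 0" using False by simp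
  have roots: "poly p x = 0 \<longleftrightarrow> x \<in># A" for x
    by (subst A(2)) (use lc in \<open>auto simp: poly_prod_mset prod_mset_zero_iff\<close>)
  have "count A x \<le> 1" for x
  proof (rule ccontr)
    assume "\<not> count A x \<le> 1"
    then have "{#x, x#} \<subseteq># A" by (simp add: subseteq_mset_def)
    then obtain C where "A = {#x, x#} + C" by (metis subset_mset.le_iff_add)
    then have "p = [:-x, 1:] * ([:-x, 1:] * Polynomial.smult (Polynomial.lead_coeff p) (\<Prod>x\<in>#C. [:-x, 1:]))"
      using A(2) by (simp add: mult.assoc)
    then obtain r where r: "p = [:-x, 1:] * ([:-x, 1:] * r)" by blast
    have "poly p x = 0" "poly (pderiv p) x = 0"
      unfolding r pderiv_mult[of "[:-x, 1:]"] poly_add poly_mult by simp_all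
    then show False using assms by blast
  qed
  then have "A = mset_set (set_mset A)"
  proof (intro multiset_eqI)
    fix x
    have "count A x = 1" if "x \<in># A"
    proof -
      have "count A x > 0" using that by simp
      then show ?thesis using \<open>\<And>x. count A x \<le> 1\<close>[of x] by linarith
    qed
    then show "count A x = count (mset_set (set_mset A)) x"
      by (cases "x \<in># A") (auto simp: not_in_iff)
  qed
  then have "size A = card (set_mset A)"
    by (metis size_mset_set)
  then show ?thesis using A(1) roots by simp
next
  case True
  then show ?thesis using assms by auto
qed

text \<open>
  The polynomial \<open>X\<^bsup>q\<^esup> - X\<close> with \<open>q = 2\<^sup>N\<close> has derivative \<open>-1\<close> in characteristic two.
\<close>
lemma card_gf2:
  assumes "N \<ge> 1"
  shows "card (gf2 N) = 2 ^ N"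
proof -
  define p :: "f2bar poly" where "p = Polynomial.monom 1 (2 ^ N) - Polynomial.monom 1 1"
  have deg: "Polynomial.degree p = 2 ^ N"
  proof -
    have "1 < (2::nat) ^ N" using assms by (intro one_less_power) auto
    then have "Polynomial.degree (Polynomial.monom (1::f2bar) 1) < Polynomial.degree (Polynomial.monom (1::f2bar) (2 ^ N))"
      by (simp add: degree_monom_eq)
    then have "Polynomial.degree (- Polynomial.monom (1::f2bar) 1 + Polynomial.monom 1 (2 ^ N)) = Polynomial.degree (Polynomial.monom (1::f2bar) (2 ^ N))"
      by (intro degree_add_eq_right) simp
    then show ?thesis by (simp add: p_def degree_monom_eq)
  qed
  have "of_nat (2 ^ N) = (0::f2bar)"
    using assms by simp
  then have der: "pderiv p = - 1"
    by (simp add: p_def pderiv_diff pderiv_monom monom_eq_1)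
  have "card {x. poly p x = 0} = Polynomial.degree p"
    by (rule card_roots_coprime_pderiv) (simp add: der)
  moreover have "{x. poly p x = 0} = gf2 N"
    by (auto simp: p_def gf2_def poly_monom)
  ultimately show ?thesis using deg by simp
qed

lemma finite_gf2: "N \<ge> 1 \<Longrightarrow> finite (gf2 N)"
  by (rule card_ge_0_finite) (simp add: card_gf2)

definition gf2_trace :: "nat \<Rightarrow> f2bar \<Rightarrow> f2bar" where
  "gf2_trace N x = (\<Sum>i<N. x ^ 2 ^ i)"

lemma gf2_trace_0 [simp]: "gf2_trace N 0 = 0"
  by (simp add: gf2_trace_def zero_power)

lemma gf2_trace_add: "gf2_trace N (x + y) = gf2_trace N x + gf2_trace N y"
  by (simp add: gf2_trace_def frobenius_add sum.distrib)

lemma idempotent_f2bar: "(t::f2bar) ^ 2 = t \<Longrightarrow> t \<in> {0, 1}"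
  by (auto simp: power2_eq_square)

text \<open>
  Squaring permutes the conjugates \<open>x\<^bsup>2^i\<^esup>\<close> cyclically, so the trace is a root of \<open>t\<^sup>2 = t\<close>.
\<close>
lemma gf2_trace_cases:
  assumes "x \<in> gf2 N" shows "gf2_trace N x \<in> {0, 1}"
proof (cases N)
  case (Suc M)
  have "gf2_trace N x ^ 2 = (\<Sum>i<N. x ^ 2 ^ Suc i)"
    by (simp add: gf2_trace_def frobenius_sum power_mult mult.commute flip: power_mult)
  also have "\<dots> = (\<Sum>i<M. x ^ 2 ^ Suc i) + x"
    using assms by (simp add: Suc gf2_def)
  also have "\<dots> = gf2_trace N x"
    unfolding gf2_trace_def Suc by (subst sum.lessThan_Suc_shift) simp
  finally show ?thesis by (rule idempotent_f2bar)
qed (simp add: gf2_trace_def)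

text \<open>
  The trace is a polynomial function of degree at most \<open>2\<^bsup>N-1\<^esup>\<close>, so it does not vanish on all \<open>2\<^sup>N\<close>
  elements; scaling by \<open>z\<close> permutes the elements.
\<close>
lemma gf2_trace_nondegenerate:
  assumes N: "N \<ge> 1" and z: "z \<in> gf2 N" "z \<noteq> 0"
  shows "\<exists>y\<in>gf2 N. gf2_trace N (z * y) = 1"
proof -
  define p :: "f2bar poly" where "p = (\<Sum>i<N. Polynomial.monom 1 (2 ^ i))"
  have pp: "poly p x = gf2_trace N x" for x
    by (simp add: p_def gf2_trace_def poly_sum poly_monom)
  have "poly.coeff p 1 = (\<Sum>i<N. if i = 0 then 1 else 0)"
    unfolding p_def coeff_sum by (intro sum.cong) auto
  also have "\<dots> = 1" using N by simp
  finally have p0: "p \<noteq> 0" by auto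
  have "Polynomial.degree p \<le> 2 ^ (N - 1)"
    unfolding p_def
    by (intro degree_sum_le) (auto simp: degree_monom_eq intro!: power_increasing)
  then have "card {x. poly p x = 0} \<le> 2 ^ (N - 1)"
    using card_poly_roots_bound[OF p0] by simp
  also have "\<dots> < 2 ^ N" using N by simp
  finally have "card {x. poly p x = 0} < card (gf2 N)" using N by (simp add: card_gf2)
  then have "\<not> gf2 N \<subseteq> {x. poly p x = 0}"
    using card_mono[OF poly_roots_finite[OF p0], of "gf2 N"] by linarith
  then obtain x where x: "x \<in> gf2 N" "gf2_trace N x \<noteq> 0" using pp by auto
  then have "gf2_trace N x = 1" using gf2_trace_cases by blast
  then show ?thesis
    using x z by (intro bexI[of _ "x / z"]) (auto simp: gf2_divide)
qed

lemma gf2_trace_1: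
  assumes "odd N" shows "gf2_trace N 1 = 1"
proof -
  obtain k where "N = 2 * k + 1" using assms by (elim oddE)
  then show ?thesis by (simp add: gf2_trace_def)
qed

text \<open>
  The second elementary symmetric polynomial in \<open>s 0, \<dots>, s (N - 1)\<close>.
\<close>
definition elem_sym2 :: "nat \<Rightarrow> (nat \<Rightarrow> 'a::comm_ring_1) \<Rightarrow> 'a" where
  "elem_sym2 N s = (\<Sum>j<N. \<Sum>i<j. s i * s j)"

text \<open>
  The mixed terms \<open>s i * t j\<close> with \<open>i \<noteq> j\<close> are all products except those with \<open>i = j\<close>.
\<close>
lemma elem_sym2_add:
  "elem_sym2 N (\<lambda>i. s i + t i) = elem_sym2 N s + elem_sym2 N t + sum s {..<N} * sum t {..<N} - (\<Sum>i<N. s i * t i)"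
  by (induction N) (simp_all add: elem_sym2_def algebra_simps sum.distrib sum_distrib_left sum_distrib_right)

text \<open>
  A symmetric polynomial does not change when its arguments are permuted.
\<close>
lemma elem_sym2_cyclic_shift:
  assumes "s N = s 0"
  shows "elem_sym2 N (\<lambda>i. s (Suc i)) = elem_sym2 N s"
proof (cases N)
  case (Suc M)
  have "elem_sym2 (Suc M) s = (\<Sum>j<M. \<Sum>i<Suc j. s i * s (Suc j))"
    unfolding elem_sym2_def by (subst sum.lessThan_Suc_shift) simp
  also have "\<dots> = (\<Sum>j<M. s 0 * s (Suc j)) + elem_sym2 M (\<lambda>i. s (Suc i))"
    by (subst sum.lessThan_Suc_shift) (simp add: elem_sym2_def sum.distrib)
  also have "\<dots> = elem_sym2 (Suc M) (\<lambda>i. s (Suc i))"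
    using assms Suc by (simp add: elem_sym2_def algebra_simps sum_distrib_left)
  finally show ?thesis by (simp add: Suc)
qed (simp add: elem_sym2_def)

text \<open>
  The second elementary symmetric polynomial in the conjugates of \<open>x\<close>: the next coefficient, after
  the trace, of the characteristic polynomial of \<open>x\<close>.
\<close>
definition trace_quad :: "nat \<Rightarrow> f2bar \<Rightarrow> f2bar" where
  "trace_quad N x = elem_sym2 N (\<lambda>i. x ^ 2 ^ i)"

lemma trace_quad_0 [simp]: "trace_quad N 0 = 0"
  by (simp add: trace_quad_def elem_sym2_def zero_power)

text \<open>
  The polar form \<open>tr x * tr y + tr (x y)\<close> is alternating.  This quadratic form serves both constructions:
  its term \<open>tr x * tr y\<close> compensates for the carry when traces are added as integers modulo 4, and
  extended to one more coordinate it becomes Kerdock's form.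
\<close>
lemma trace_quad_add: "trace_quad N (x + y) = trace_quad N x + trace_quad N y + gf2_trace N x * gf2_trace N y + gf2_trace N (x * y)"
  by (simp add: trace_quad_def frobenius_add elem_sym2_add gf2_trace_def power_mult_distrib f2bar_diff)

lemma trace_quad_cases:
  assumes "x \<in> gf2 N" shows "trace_quad N x \<in> {0, 1}"
proof (rule idempotent_f2bar)
  have "trace_quad N x ^ 2 = elem_sym2 N (\<lambda>i. x ^ 2 ^ Suc i)"
    by (simp add: trace_quad_def elem_sym2_def frobenius_sum power_mult_distrib mult.commute flip: power_mult)
  also have "\<dots> = trace_quad N x"
    unfolding trace_quad_def using assms by (intro elem_sym2_cyclic_shift[of "\<lambda>i. x ^ 2 ^ i"]) (simp add: gf2_def)
  finally show "trace_quad N x ^ 2 = trace_quad N x" .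
qed

text \<open>
  On \<open>{0, 1}\<close> this is the nontrivial additive character of the field with two elements.
\<close>
definition bit_sign :: "f2bar \<Rightarrow> complex" where
  "bit_sign v = (if v = 0 then 1 else - 1)"

lemma bit_sign_simps [simp]: "bit_sign 0 = 1" "bit_sign 1 = - 1" "cmod (bit_sign v) = 1" "bit_sign v * bit_sign v = 1" "bit_sign v \<in> \<real>"
  "cnj (bit_sign v) = bit_sign v"
  by (simp_all add: bit_sign_def)

lemma bit_sign_add: "u \<in> {0, 1} \<Longrightarrow> v \<in> {0, 1} \<Longrightarrow> bit_sign (u + v) = bit_sign u * bit_sign v"
  by (auto simp: bit_sign_def)

text \<open>
  This is \<open>\<i>\<close> to the power \<open>tr x + 2 * trace_quad x\<close>, a quadratic form with values in the integers
  modulo 4.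
\<close>
definition quartic_phase :: "nat \<Rightarrow> f2bar \<Rightarrow> complex" where
  "quartic_phase N x = (if gf2_trace N x = 0 then 1 else \<i>) * bit_sign (trace_quad N x)"

lemma cmod_quartic_phase: "cmod (quartic_phase N x) = 1"
  by (simp add: quartic_phase_def norm_mult)

text \<open>
  If \<open>tr x = tr y = 1\<close>, then \<open>tr (x + y) = 0\<close> although the exponents of \<open>\<i>\<close> add up to \<open>2\<close>.  The
  resulting sign is cancelled by the term \<open>tr x * tr y\<close> in the polar form of \<open>trace_quad\<close>, and only
  \<open>tr (x y)\<close> is left.
\<close>
lemma quartic_phase_add:
  assumes x: "x \<in> gf2 N" and y: "y \<in> gf2 N"
  shows "quartic_phase N (x + y) = quartic_phase N x * quartic_phase N y * bit_sign (gf2_trace N (x * y))"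
proof -
  have "trace_quad N x \<in> {0, 1}" "trace_quad N y \<in> {0, 1}" "gf2_trace N (x * y) \<in> {0, 1}"
    "gf2_trace N x \<in> {0, 1}" "gf2_trace N y \<in> {0, 1}"
    using assms by (auto simp only: trace_quad_cases gf2_trace_cases gf2_mult)
  then show ?thesis
    by (auto simp: quartic_phase_def trace_quad_add gf2_trace_add bit_sign_def)
qed

lemma sum_translate:
  fixes f :: "'a::ab_group_add \<Rightarrow> complex"
  assumes fin: "finite G" and add: "\<And>x y. x \<in> G \<Longrightarrow> y \<in> G \<Longrightarrow> x + y \<in> G" and a: "a \<in> G"
  shows "(\<Sum>x\<in>G. f (a + x)) = sum f G"
proof -
  have "(+) a ` G = G"
    using fin add a by (intro endo_inj_surj) (auto simp: inj_on_def)
  then show ?thesis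
    using sum.reindex[of "(+) a" G f] by (simp add: inj_on_def)
qed

text \<open>
  Translation by \<open>a\<close> multiplies the sum by \<open>\<psi> a \<noteq> 1\<close> without changing it.
\<close>
lemma character_sum_0:
  fixes \<psi> :: "'a::ab_group_add \<Rightarrow> complex"
  assumes fin: "finite G" and add: "\<And>x y. x \<in> G \<Longrightarrow> y \<in> G \<Longrightarrow> x + y \<in> G"
    and hom: "\<And>x y. x \<in> G \<Longrightarrow> y \<in> G \<Longrightarrow> \<psi> (x + y) = \<psi> x * \<psi> y"
    and a: "a \<in> G" "\<psi> a \<noteq> 1"
  shows "sum \<psi> G = 0"
proof -
  have "sum \<psi> G = (\<Sum>x\<in>G. \<psi> (a + x))"
    using sum_translate[OF fin add a(1)] by simp
  also have "\<dots> = \<psi> a * sum \<psi> G"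
    using a hom by (simp add: sum_distrib_left)
  finally show ?thesis using a by (simp add: mult_cancel_right1)
qed

text \<open>
  Expand the square as a double sum and substitute \<open>x = y + z\<close>: the term for \<open>y, z\<close> becomes
  \<open>f z * \<beta> z y\<close>, whose sum over \<open>y\<close> vanishes unless \<open>z = 0\<close>.
\<close>
lemma sum_quadratic_phase:
  fixes f :: "'a::ab_group_add \<Rightarrow> complex"
  assumes fin: "finite G" and zero: "0 \<in> G" and add: "\<And>x y. x \<in> G \<Longrightarrow> y \<in> G \<Longrightarrow> x + y \<in> G"
    and unimod: "\<And>x. x \<in> G \<Longrightarrow> cmod (f x) = 1"
    and quad: "\<And>x y. x \<in> G \<Longrightarrow> y \<in> G \<Longrightarrow> f (x + y) = f x * f y * \<beta> x y"
    and nondeg: "\<And>z. z \<in> G \<Longrightarrow> z \<noteq> 0 \<Longrightarrow> (\<Sum>y\<in>G. \<beta> z y) = 0"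
  shows "(cmod (sum f G))\<^sup>2 = card G"
proof -
  have unit: "f y * cnj (f y) = 1" if "y \<in> G" for y
    using unimod[OF that] by (simp flip: complex_norm_square)
  have f0: "\<beta> 0 y = 1 / f 0" if "y \<in> G" for y
  proof -
    have "f 0 \<noteq> 0" "f y \<noteq> 0" using unimod[OF that] unimod[OF zero] by auto
    then have "f 0 * \<beta> 0 y = 1" using quad[OF zero that] by simp
    then show ?thesis using \<open>f 0 \<noteq> 0\<close> by (simp add: field_simps)
  qed
  have "complex_of_real ((cmod (sum f G))\<^sup>2) = sum f G * cnj (sum f G)"
    by (simp only: complex_norm_square)
  also have "\<dots> = (\<Sum>y\<in>G. (\<Sum>x\<in>G. f x) * cnj (f y))"
    by (simp add: sum_distrib_left)
  also have "\<dots> = (\<Sum>y\<in>G. \<Sum>z\<in>G. f (y + z) * cnj (f y))"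
  proof (rule sum.cong)
    fix y assume y: "y \<in> G"
    have "(\<Sum>x\<in>G. f x) = (\<Sum>z\<in>G. f (y + z))"
      using sum_translate[OF fin add y] by simp
    then show "(\<Sum>x\<in>G. f x) * cnj (f y) = (\<Sum>z\<in>G. f (y + z) * cnj (f y))"
      by (simp add: sum_distrib_right)
  qed simp
  also have "\<dots> = (\<Sum>y\<in>G. \<Sum>z\<in>G. f z * \<beta> z y)"
  proof (intro sum.cong refl)
    fix y z assume "y \<in> G" "z \<in> G"
    then show "f (y + z) * cnj (f y) = f z * \<beta> z y"
      using quad[of z y] unit[of y] by (simp add: add.commute mult.assoc mult.left_commute)
  qed
  also have "\<dots> = (\<Sum>z\<in>G. f z * (\<Sum>y\<in>G. \<beta> z y))"
    by (subst sum.swap) (simp add: sum_distrib_left)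
  also have "\<dots> = (\<Sum>z\<in>{0}. f z * (\<Sum>y\<in>G. \<beta> z y))"
    using fin zero nondeg by (intro sum.mono_neutral_right) auto
  also have "\<dots> = of_nat (card G)"
    using f0 unimod[OF zero] by auto
  finally show ?thesis
    by (metis of_real_eq_iff of_real_of_nat_eq)
qed

section \<open>Maximal sets of mutually unbiased bases\<close>

text \<open>
  A square matrix with orthonormal rows has orthonormal columns.  Orthonormality of columns says that
  every vector is the sum of its projections, and the coefficients are inner products of vectors
  over \<open>F\<close>.
\<close>
lemma orthonormal_imp_basis:
  fixes b :: "nat \<Rightarrow> complex ^ 'n"
  assumes F: "F = \<real> \<or> F = UNIV" and mem: "\<And>j. j \<in> {1..CARD('n)} \<Longrightarrow> b j \<in> vec_over F"
    and on: "\<And>i j. i \<in> {1..CARD('n)} \<Longrightarrow> j \<in> {1..CARD('n)} \<Longrightarrow> cinner (b i) (b j) = (if i = j then 1 else 0)"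
  shows "orthonormal_basis F b"
proof -
  obtain h :: "'n \<Rightarrow> nat" where h: "bij_betw h UNIV {1..CARD('n)}"
    using finite_same_card_bij[of "UNIV :: 'n set" "{1..CARD('n)}"] by auto
  have h_mem: "h i \<in> {1..CARD('n)}" for i using h by (auto simp: bij_betw_def)
  have h_inj: "h i = h j \<longleftrightarrow> i = j" for i j using h by (auto simp: bij_betw_def inj_on_def)
  define U :: "complex ^ 'n ^ 'n" where "U = (\<chi> i k. b (h i) $ k)"
  define V :: "complex ^ 'n ^ 'n" where "V = (\<chi> k j. cnj (b (h j) $ k))"
  have "(U ** V) $ i $ j = mat 1 $ i $ j" for i j
    using on[OF h_mem h_mem, of i j]
    by (simp add: U_def V_def matrix_matrix_mult_def mat_def cinner_def h_inj)
  then have "U ** V = mat 1" by (simp add: vec_eq_iff)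
  then have VU: "V ** U = mat 1" by (simp add: matrix_left_right_inverse)
  have complete: "(\<Sum>j=1..CARD('n). cnj (b j $ k) * b j $ i) = (if k = i then 1 else 0)" for i k
  proof -
    have "(\<Sum>j=1..CARD('n). cnj (b j $ k) * b j $ i) = (\<Sum>j\<in>UNIV. cnj (b (h j) $ k) * b (h j) $ i)"
      by (rule sum.reindex_bij_betw[OF h, symmetric])
    also have "\<dots> = (V ** U) $ k $ i" by (simp add: U_def V_def matrix_matrix_mult_def)
    finally show ?thesis by (simp add: VU mat_def)
  qed
  have "\<exists>c. (\<forall>j. c j \<in> F) \<and> x = (\<Sum>j=1..CARD('n). c j *s b j)" if x: "x \<in> vec_over F" for x
  proof (intro exI conjI allI)
    let ?c = "\<lambda>j. if j \<in> {1..CARD('n)} then cinner x (b j) else 0"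
    show "?c j \<in> F" for j
      using F x mem[of j] by (auto simp: cinner_def vec_over_def Reals_cnj_iff intro!: sum_in_Reals Reals_mult)
    have "(\<Sum>j=1..CARD('n). ?c j *s b j) $ i = x $ i" for i
    proof -
      have "(\<Sum>j=1..CARD('n). ?c j *s b j) $ i = (\<Sum>j=1..CARD('n). \<Sum>k\<in>UNIV. x $ k * (cnj (b j $ k) * b j $ i))"
        by (simp add: cinner_def sum_distrib_right mult.assoc)
      also have "\<dots> = (\<Sum>k\<in>UNIV. x $ k * (\<Sum>j=1..CARD('n). cnj (b j $ k) * b j $ i))"
        by (subst sum.swap) (simp add: sum_distrib_left)
      finally show ?thesis unfolding complete by (simp add: if_distrib[of "\<lambda>y. _ * y"] cong: if_cong)
    qed
    then show "x = (\<Sum>j=1..CARD('n). ?c j *s b j)" by (simp add: vec_eq_iff)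
  qed
  then show ?thesis
    using mem on by (simp add: orthonormal_basis_def)
qed

lemma mutually_unbiased_commute:
  assumes "mutually_unbiased b b'" shows "mutually_unbiased b' b"
proof -
  have "cmod (cinner x y) = cmod (cinner y x)" for x y :: "complex ^ 'n"
  proof -
    have "cinner x y = cnj (cinner y x)" by (simp add: cinner_def mult.commute)
    then show ?thesis by simp
  qed
  then show ?thesis using assms unfolding mutually_unbiased_def by metis
qed

text \<open>
  Coordinates are indexed by the group \<open>G\<close>.  Basis number \<open>0\<close> is the standard basis; the others
  consist of the vectors \<open>x \<mapsto> f a x * \<psi> u x / sqrt m\<close>, with one basis for each \<open>a\<close> and one vector for
  each character \<open>\<psi> u\<close>.  Within a basis the phases cancel and orthogonality of characters remains.
  Between two phase bases the inner product is a sum to which \<open>sum_quadratic_phase\<close> applies.  All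
  entries have absolute value \<open>1 / sqrt m\<close>, which makes these bases unbiased to the standard one.
\<close>
lemma quadratic_phase_mubs:
  fixes G :: "'a::ab_group_add set" and \<psi> :: "'a \<Rightarrow> 'a \<Rightarrow> complex"
    and f :: "'i \<Rightarrow> 'a \<Rightarrow> complex" and \<beta> :: "'i \<Rightarrow> 'a \<Rightarrow> 'a \<Rightarrow> complex"
  assumes F: "F = \<real> \<or> F = UNIV"
    and G: "finite G" "card G = CARD('n)" "0 \<in> G" "\<And>x y. x \<in> G \<Longrightarrow> y \<in> G \<Longrightarrow> x + y \<in> G"
    and psi_sign: "\<And>u x. \<psi> u x \<in> {1, - 1}"
    and psi_hom: "\<And>u x y. u \<in> G \<Longrightarrow> x \<in> G \<Longrightarrow> y \<in> G \<Longrightarrow> \<psi> u (x + y) = \<psi> u x * \<psi> u y"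
    and psi_sep: "\<And>u v. u \<in> G \<Longrightarrow> v \<in> G \<Longrightarrow> u \<noteq> v \<Longrightarrow> \<exists>x\<in>G. \<psi> u x \<noteq> \<psi> v x"
    and A: "finite A"
    and f_F: "\<And>a x. a \<in> A \<Longrightarrow> x \<in> G \<Longrightarrow> f a x \<in> F"
    and f_unit: "\<And>a x. a \<in> A \<Longrightarrow> x \<in> G \<Longrightarrow> cmod (f a x) = 1"
    and f_quad: "\<And>a x y. a \<in> A \<Longrightarrow> x \<in> G \<Longrightarrow> y \<in> G \<Longrightarrow> f a (x + y) = f a x * f a y * \<beta> a x y"
    and beta_sign: "\<And>a x y. \<beta> a x y \<in> {1, - 1}"
    and beta_hom: "\<And>a z x y. a \<in> A \<Longrightarrow> z \<in> G \<Longrightarrow> x \<in> G \<Longrightarrow> y \<in> G \<Longrightarrow> \<beta> a z (x + y) = \<beta> a z x * \<beta> a z y"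
    and beta_sep: "\<And>a a' z. a \<in> A \<Longrightarrow> a' \<in> A \<Longrightarrow> a \<noteq> a' \<Longrightarrow> z \<in> G \<Longrightarrow> z \<noteq> 0 \<Longrightarrow> \<exists>y\<in>G. \<beta> a z y \<noteq> \<beta> a' z y"
  shows "\<exists>(K :: nat set) (B :: nat \<Rightarrow> nat \<Rightarrow> complex ^ 'n).
    mub_family F K B \<and> finite K \<and> card K = card A + 1"
proof -
  define m where "m = CARD('n)"
  have m: "real m > 0" by (simp add: m_def)
  obtain e :: "'n \<Rightarrow> 'a" where e: "bij_betw e UNIV G"
    using finite_same_card_bij[of "UNIV :: 'n set" G] G by auto
  obtain h where h: "bij_betw h {1..m} G"
    using ex_bij_betw_nat_finite_1[OF G(1)] G(2) by (auto simp: m_def)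
  obtain \<kappa> where \<kappa>: "bij_betw \<kappa> {1..card A} A"
    using ex_bij_betw_nat_finite_1[OF A] by blast
  have e_mem: "e i \<in> G" for i using e by (auto simp: bij_betw_def)
  have h_mem: "h j \<in> G" if "j \<in> {1..m}" for j using h that by (auto simp: bij_betw_def)
  have h_inj: "h i = h j \<longleftrightarrow> i = j" if "i \<in> {1..m}" "j \<in> {1..m}" for i j
    using h that by (metis bij_betw_def inj_on_eq_iff)
  have \<kappa>_mem: "\<kappa> k \<in> A" if "k \<in> {1..card A}" for k using \<kappa> that by (auto simp: bij_betw_def)
  have \<kappa>_inj: "\<kappa> k \<noteq> \<kappa> k'" if "k \<in> {1..card A}" "k' \<in> {1..card A}" "k \<noteq> k'" for k k'
    using \<kappa> that by (metis bij_betw_def inj_on_eq_iff)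
  have sign: "s \<in> \<real> \<and> cnj s = s \<and> cmod s = 1 \<and> s * s = 1" if "s \<in> {1, - 1}" for s :: complex
    using that by (elim insertE) simp_all
  have psi_real: "\<psi> u x \<in> \<real>" "cnj (\<psi> u x) = \<psi> u x" "cmod (\<psi> u x) = 1" "\<psi> u x * \<psi> u x = 1" for u x
    using sign[OF psi_sign[of u x]] by blast+
  have sign_cancel: "s = t" if "s * t = 1" "t * t = 1" for s t :: complex
  proof -
    have "s = s * (t * t)" using that by simp
    also have "\<dots> = (s * t) * t" by (simp only: mult.assoc)
    finally show ?thesis using that by simp
  qed
  have psi_orth: "(\<Sum>x\<in>G. \<psi> u x * \<psi> v x) = (if u = v then of_nat m else 0)" if uv: "u \<in> G" "v \<in> G" for u v
  proof (cases "u = v")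
    case True
    then show ?thesis using psi_real G by (simp add: m_def)
  next
    case False
    then obtain a where a: "a \<in> G" "\<psi> u a \<noteq> \<psi> v a" using psi_sep uv by blast
    then have "\<psi> u a * \<psi> v a \<noteq> 1" using sign_cancel psi_real(4) by blast
    then show ?thesis
      using False character_sum_0[of G "\<lambda>x. \<psi> u x * \<psi> v x" a] G a(1) psi_hom uv by simp
  qed
  define s where "s = 1 / sqrt (real m)"
  have s: "s * s = 1 / real m" "\<bar>s\<bar> * \<bar>s\<bar> = 1 / real m" using m by (simp_all add: s_def)
  define c where "c = complex_of_real s"
  have c: "c * cnj c = of_real (1 / real m)" "(cmod c)\<^sup>2 = 1 / real m" "c \<in> \<real>"
    unfolding s(1)[symmetric] by (simp_all add: c_def power2_eq_square)
  define B :: "nat \<Rightarrow> nat \<Rightarrow> complex ^ 'n" where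
    "B k j = (if k = 0 then (\<chi> i. if e i = h j then 1 else 0)
              else (\<chi> i. c * f (\<kappa> k) (e i) * \<psi> (h j) (e i)))" for k j
  have inner_phase: "cinner (B k j) (B k' j')
      = of_real (1 / real m) * (\<Sum>x\<in>G. f (\<kappa> k) x * cnj (f (\<kappa> k') x) * (\<psi> (h j) x * \<psi> (h j') x))"
    if "k \<noteq> 0" "k' \<noteq> 0" for k k' j j'
  proof -
    have "cinner (B k j) (B k' j')
        = (\<Sum>i\<in>UNIV. (c * cnj c) * (f (\<kappa> k) (e i) * cnj (f (\<kappa> k') (e i)) * (\<psi> (h j) (e i) * \<psi> (h j') (e i))))"
      unfolding cinner_def using that by (intro sum.cong) (simp_all add: B_def psi_real mult_ac)
    also have "\<dots> = (\<Sum>x\<in>G. (c * cnj c) * (f (\<kappa> k) x * cnj (f (\<kappa> k') x) * (\<psi> (h j) x * \<psi> (h j') x)))"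
      by (rule sum.reindex_bij_betw[OF e])
    finally show ?thesis by (simp add: c sum_distrib_left)
  qed
  have inner_std: "cinner (B 0 j) (B k j') = cnj (c * f (\<kappa> k) (h j) * \<psi> (h j') (h j))"
    if "k \<noteq> 0" "j \<in> {1..m}" for k j j'
  proof -
    have "cinner (B 0 j) (B k j') = (\<Sum>i\<in>UNIV. if e i = h j then cnj (c * f (\<kappa> k) (e i) * \<psi> (h j') (e i)) else 0)"
      unfolding cinner_def using that by (intro sum.cong) (simp_all add: B_def)
    also have "\<dots> = (\<Sum>x\<in>G. if x = h j then cnj (c * f (\<kappa> k) x * \<psi> (h j') x) else 0)"
      by (rule sum.reindex_bij_betw[OF e])
    also have "\<dots> = cnj (c * f (\<kappa> k) (h j) * \<psi> (h j') (h j))"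
      using G(1) h_mem[OF that(2)] by simp
    finally show ?thesis .
  qed
  have basis: "orthonormal_basis F (B k)" if k: "k \<in> {0..card A}" for k
  proof (rule orthonormal_imp_basis[OF F], unfold m_def[symmetric])
    fix j assume j: "j \<in> {1..m}"
    show "B k j \<in> vec_over F"
      using F c(3) psi_real(1) f_F[OF \<kappa>_mem[of k] e_mem] k
      by (auto simp: vec_over_def B_def intro!: Reals_mult)
  next
    fix i j assume ij: "i \<in> {1..m}" "j \<in> {1..m}"
    show "cinner (B k i) (B k j) = (if i = j then 1 else 0)"
    proof (cases "k = 0")
      case True
      have "cinner (B k i) (B k j) = (\<Sum>l\<in>UNIV. if e l = h i then of_bool (e l = h j) else 0)"
        unfolding cinner_def using True by (intro sum.cong) (simp_all add: B_def)
      also have "\<dots> = (\<Sum>x\<in>G. if x = h i then of_bool (x = h j) else 0)"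
        by (rule sum.reindex_bij_betw[OF e])
      also have "\<dots> = of_bool (h i = h j)"
        using G(1) h_mem[OF ij(1)] by simp
      finally show ?thesis using h_inj[OF ij] by simp
    next
      case False
      then have kA: "\<kappa> k \<in> A" using k by (intro \<kappa>_mem) simp
      have "f (\<kappa> k) x * cnj (f (\<kappa> k) x) = 1" if "x \<in> G" for x
        using f_unit[OF kA that] by (simp flip: complex_norm_square)
      then have "cinner (B k i) (B k j) = of_real (1 / real m) * (\<Sum>x\<in>G. \<psi> (h i) x * \<psi> (h j) x)"
        using False by (simp add: inner_phase)
      then show ?thesis
        using psi_orth[OF h_mem[OF ij(1)] h_mem[OF ij(2)]] h_inj[OF ij] m by simp
    qed
  qed
  have unb_std: "mutually_unbiased (B 0) (B k)" if k: "k \<in> {1..card A}" for k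
    unfolding mutually_unbiased_def m_def[symmetric]
  proof (intro ballI)
    fix j j' assume "j \<in> {1..m}" "j' \<in> {1..m}"
    then show "(cmod (cinner (B 0 j) (B k j')))\<^sup>2 = 1 / real m"
      using k f_unit[OF \<kappa>_mem[OF k] h_mem] by (simp add: inner_std norm_mult psi_real c(2))
  qed
  have unb_phase: "mutually_unbiased (B k) (B k')"
    if k: "k \<in> {1..card A}" "k' \<in> {1..card A}" "k \<noteq> k'" for k k'
    unfolding mutually_unbiased_def m_def[symmetric]
  proof (intro ballI)
    fix j j' assume j: "j \<in> {1..m}" "j' \<in> {1..m}"
    define a a' u u' where "a = \<kappa> k" and "a' = \<kappa> k'" and "u = h j" and "u' = h j'"
    have a: "a \<in> A" "a' \<in> A" "a \<noteq> a'" and u: "u \<in> G" "u' \<in> G"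
      using \<kappa>_mem \<kappa>_inj h_mem k j by (auto simp: a_def a'_def u_def u'_def)
    have cnj_beta: "cnj (\<beta> a' x y) = \<beta> a' x y" for x y using sign[OF beta_sign[of a' x y]] by blast
    let ?g = "\<lambda>x. f a x * cnj (f a' x) * (\<psi> u x * \<psi> u' x)"
    have "(cmod (sum ?g G))\<^sup>2 = card G"
    proof (rule sum_quadratic_phase[OF G(1,3,4)])
      show "cmod (?g x) = 1" if "x \<in> G" for x
        using that a by (simp add: norm_mult f_unit psi_real)
      show "?g (x + y) = ?g x * ?g y * (\<beta> a x y * \<beta> a' x y)" if "x \<in> G" "y \<in> G" for x y
        using that a u by (simp add: f_quad psi_hom cnj_beta mult_ac)
      show "(\<Sum>y\<in>G. \<beta> a z y * \<beta> a' z y) = 0" if z: "z \<in> G" "z \<noteq> 0" for z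
      proof -
        obtain y where y: "y \<in> G" "\<beta> a z y \<noteq> \<beta> a' z y" using beta_sep[OF a z] by blast
        then have "\<beta> a z y * \<beta> a' z y \<noteq> 1"
          using sign_cancel sign[OF beta_sign] by blast
        then show ?thesis
          using character_sum_0[of G "\<lambda>y. \<beta> a z y * \<beta> a' z y" y] G y(1) beta_hom a z by simp
      qed
    qed
    then have "(cmod (sum ?g G))\<^sup>2 = real m" using G by (simp add: m_def)
    moreover have "cinner (B k j) (B k' j') = of_real (1 / real m) * sum ?g G"
      using k by (simp add: inner_phase a_def a'_def u_def u'_def)
    ultimately show "(cmod (cinner (B k j) (B k' j')))\<^sup>2 = 1 / real m"
      using m by (simp add: norm_mult norm_divide power_mult_distrib power_divide) (simp add: power2_eq_square)
  qed
  have "mub_family F {0..card A} B"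
    unfolding mub_family_def
  proof (intro conjI ballI impI)
    fix k k' assume "k \<in> {0..card A}" "k' \<in> {0..card A}" "k \<noteq> k'"
    then have "k = 0 \<and> k' \<in> {1..card A} \<or> k' = 0 \<and> k \<in> {1..card A}
        \<or> k \<in> {1..card A} \<and> k' \<in> {1..card A} \<and> k \<noteq> k'" by auto
    then consider "k = 0" "k' \<in> {1..card A}" | "k' = 0" "k \<in> {1..card A}"
      | "k \<in> {1..card A}" "k' \<in> {1..card A}" "k \<noteq> k'" by blast
    then show "mutually_unbiased (B k) (B k')"
    proof cases
      case 1
      then show ?thesis using unb_std[OF 1(2)] by simp
    next
      case 2
      then show ?thesis using mutually_unbiased_commute[OF unb_std[OF 2(2)]] by simp
    qed (rule unb_phase)
  qed (rule basis)
  then show ?thesis by (intro exI[of _ "{0..card A}"] exI[of _ B]) simp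
qed

lemma bit_sign_neq: "u \<in> {0, 1} \<Longrightarrow> u + v = 1 \<Longrightarrow> bit_sign u \<noteq> bit_sign v"
  by (auto simp: bit_sign_def)

text \<open>
  The phases \<open>x \<mapsto> quartic_phase (c x)\<close> have the bicharacters \<open>tr (c\<^sup>2 x y)\<close>, and for \<open>c \<noteq> c'\<close> the
  difference \<open>tr ((c + c')\<^sup>2 x y)\<close> is nondegenerate.
\<close>
lemma complex_mubs_exist:
  assumes m: "CARD('n) = 2 ^ r" "CARD('n) > 2"
  shows "\<exists>(K :: nat set) (B :: nat \<Rightarrow> nat \<Rightarrow> complex ^ 'n). maximal_mub_family UNIV K B"
proof -
  have r: "r \<ge> 1" using m by (cases r) auto
  have "\<exists>(K :: nat set) (B :: nat \<Rightarrow> nat \<Rightarrow> complex ^ 'n).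
      mub_family UNIV K B \<and> finite K \<and> card K = card (gf2 r) + 1"
  proof (rule quadratic_phase_mubs[where G = "gf2 r" and \<psi> = "\<lambda>u x. bit_sign (gf2_trace r (u * x))"
        and f = "\<lambda>c x. quartic_phase r (c * x)" and \<beta> = "\<lambda>c x y. bit_sign (gf2_trace r (c * x * (c * y)))"])
    show "\<exists>x\<in>gf2 r. bit_sign (gf2_trace r (u * x)) \<noteq> bit_sign (gf2_trace r (v * x))" if "u \<in> gf2 r" "v \<in> gf2 r" "u \<noteq> v" for u v
    proof -
      have "u + v \<in> gf2 r" "u + v \<noteq> 0" using that by (simp_all add: gf2_add f2bar_add_eq_0_iff)
      then obtain y where "y \<in> gf2 r" "gf2_trace r ((u + v) * y) = 1" using gf2_trace_nondegenerate[OF r] by blast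
      then show ?thesis
        using that by (intro bexI[of _ y] bit_sign_neq gf2_trace_cases gf2_mult) (simp_all add: distrib_right gf2_trace_add)
    qed
    show "\<exists>y\<in>gf2 r. bit_sign (gf2_trace r (c * z * (c * y))) \<noteq> bit_sign (gf2_trace r (c' * z * (c' * y)))"
      if "c \<in> gf2 r" "c' \<in> gf2 r" "c \<noteq> c'" "z \<in> gf2 r" "z \<noteq> 0" for c c' z
    proof -
      have "(c + c') * (c + c') * z \<in> gf2 r" "(c + c') * (c + c') * z \<noteq> 0"
        using that by (simp_all add: gf2_add gf2_mult f2bar_add_eq_0_iff)
      moreover have "(c + c') * (c + c') * z = c * z * c + c' * z * c'"
      proof -
        have "(c + c') * (c + c') * z = c * z * c + c' * z * c' + (c * c' * z + c * c' * z)"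
          by (simp only: algebra_simps)
        then show ?thesis by (simp only: f2bar_double add_0_right)
      qed
      ultimately obtain y where "y \<in> gf2 r" "gf2_trace r ((c * z * c + c' * z * c') * y) = 1"
        using gf2_trace_nondegenerate[OF r] by metis
      then show ?thesis
        using that by (intro bexI[of _ y] bit_sign_neq gf2_trace_cases gf2_mult) (simp_all add: distrib_right gf2_trace_add mult.assoc)
    qed
    show "bit_sign (gf2_trace r (u * (x + y))) = bit_sign (gf2_trace r (u * x)) * bit_sign (gf2_trace r (u * y))"
      if "u \<in> gf2 r" "x \<in> gf2 r" "y \<in> gf2 r" for u x y
      using that unfolding distrib_left gf2_trace_add by (intro bit_sign_add gf2_trace_cases gf2_mult)
    show "bit_sign (gf2_trace r (c * z * (c * (x + y)))) = bit_sign (gf2_trace r (c * z * (c * x))) * bit_sign (gf2_trace r (c * z * (c * y)))"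
      if "c \<in> gf2 r" "z \<in> gf2 r" "x \<in> gf2 r" "y \<in> gf2 r" for c z x y
      using that unfolding distrib_left gf2_trace_add by (intro bit_sign_add gf2_trace_cases gf2_mult)
    show "quartic_phase r (c * (x + y)) = quartic_phase r (c * x) * quartic_phase r (c * y) * bit_sign (gf2_trace r (c * x * (c * y)))"
      if "c \<in> gf2 r" "x \<in> gf2 r" "y \<in> gf2 r" for c x y
      using that unfolding distrib_left by (intro quartic_phase_add gf2_mult)
    show "bit_sign v \<in> {1, - 1}" for v by (simp add: bit_sign_def)
    show "bit_sign v \<in> {1, - 1}" for v by (simp add: bit_sign_def)
    show "finite (gf2 r)" "finite (gf2 r)" "card (gf2 r) = CARD('n)"
      using finite_gf2[OF r] card_gf2[OF r] m by simp_all
  qed (auto intro: gf2_add simp: cmod_quartic_phase)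
  moreover have "(UNIV :: complex set) \<noteq> \<real>"
    using complex_is_Real_iff[of \<i>] by (metis UNIV_I imaginary_unit.sel(2) zero_neq_one)
  then have "mub_bound UNIV CARD('n) = real (card (gf2 r) + 1)"
    unfolding mub_bound_def using card_gf2[OF r] m(1) by (simp only: if_False)
  ultimately show ?thesis
    unfolding maximal_mub_family_def by metis
qed

lemma bit_values_closed:
  "(u::f2bar) \<in> {0, 1} \<Longrightarrow> v \<in> {0, 1} \<Longrightarrow> u + v \<in> {0, 1}"
  "(u::f2bar) \<in> {0, 1} \<Longrightarrow> v \<in> {0, 1} \<Longrightarrow> u * v \<in> {0, 1}"
  by auto

lemma gf2_trace_scale_bit: "t \<in> {0, 1} \<Longrightarrow> gf2_trace N (t * x) = t * gf2_trace N x"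
  by auto

text \<open>
  Kerdock's quadratic form attached to the field element \<open>a\<close>, on pairs of a field element and a bit.
\<close>
definition kerdock_quad :: "nat \<Rightarrow> f2bar \<Rightarrow> f2bar \<times> f2bar \<Rightarrow> f2bar" where
  "kerdock_quad N a = (\<lambda>(x, \<epsilon>). trace_quad N (a * x) + \<epsilon> * gf2_trace N (a * x))"

text \<open>
  The polar form of \<^const>\<open>kerdock_quad\<close>.
\<close>
definition kerdock_bilinear :: "nat \<Rightarrow> f2bar \<Rightarrow> f2bar \<times> f2bar \<Rightarrow> f2bar \<times> f2bar \<Rightarrow> f2bar" where
  "kerdock_bilinear N a = (\<lambda>(x, \<epsilon>) (y, \<delta>).
     gf2_trace N (a * x) * gf2_trace N (a * y) + gf2_trace N (a * x * (a * y)) + \<epsilon> * gf2_trace N (a * y) + \<delta> * gf2_trace N (a * x))"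

lemma kerdock_quad_add:
  "kerdock_quad N a (x + y) = kerdock_quad N a x + kerdock_quad N a y + kerdock_bilinear N a x y"
  by (cases x; cases y)
     (simp add: kerdock_quad_def kerdock_bilinear_def distrib_left trace_quad_add gf2_trace_add distrib_right add_ac)

lemma kerdock_bilinear_add:
  "kerdock_bilinear N a z (x + y) = kerdock_bilinear N a z x + kerdock_bilinear N a z y"
  by (cases x; cases y; cases z)
     (simp add: kerdock_bilinear_def distrib_left gf2_trace_add distrib_right add_ac)

lemma kerdock_quad_cases:
  assumes "a \<in> gf2 N" "x \<in> gf2 N \<times> {0, 1}" shows "kerdock_quad N a x \<in> {0, 1}"
proof -
  obtain y \<epsilon> where x: "x = (y, \<epsilon>)" "y \<in> gf2 N" "\<epsilon> \<in> {0, 1}" using assms by blast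
  show ?thesis
    unfolding kerdock_quad_def x case_prod_conv
    by (intro bit_values_closed trace_quad_cases gf2_trace_cases gf2_mult assms x)
qed

lemma kerdock_bilinear_cases:
  assumes "a \<in> gf2 N" "x \<in> gf2 N \<times> {0, 1}" "y \<in> gf2 N \<times> {0, 1}"
  shows "kerdock_bilinear N a x y \<in> {0, 1}"
proof -
  obtain x' \<epsilon> where x: "x = (x', \<epsilon>)" "x' \<in> gf2 N" "\<epsilon> \<in> {0, 1}" using assms by blast
  obtain y' \<delta> where y: "y = (y', \<delta>)" "y' \<in> gf2 N" "\<delta> \<in> {0, 1}" using assms by blast
  show ?thesis
    unfolding kerdock_bilinear_def x y case_prod_conv
    by (intro bit_values_closed gf2_trace_cases gf2_mult assms x y)
qed

text \<open>
  The sum of two of the polar forms is nondegenerate.  Suppose that \<open>(x, \<epsilon>)\<close> is in its radical and put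
  \<open>s = a + b\<close>.  Testing against \<open>(0, 1)\<close> gives \<open>tr (a x) = tr (b x) = t\<close>, so \<open>tr (s x) = 0\<close>.  Testing against
  \<open>(y, 0)\<close> for all \<open>y\<close> gives \<open>s x = t + \<epsilon>\<close>, which is \<open>0\<close> or \<open>1\<close>; since \<open>N\<close> is odd, \<open>tr 1 = 1\<close>, so
  \<open>s x = 0\<close>.  Then \<open>x\<close>, \<open>t\<close> and \<open>\<epsilon>\<close> vanish in turn.
\<close>
lemma kerdock_separation:
  assumes N: "odd N" and a: "a \<in> gf2 N" "b \<in> gf2 N" "a \<noteq> b"
    and z: "z \<in> gf2 N \<times> {0, 1}" "z \<noteq> 0"
  shows "\<exists>y\<in>gf2 N \<times> {0, 1}. kerdock_bilinear N a z y + kerdock_bilinear N b z y = 1"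
proof -
  obtain x \<epsilon> where x: "z = (x, \<epsilon>)" "x \<in> gf2 N" "\<epsilon> \<in> {0, 1}" using z by blast
  have t: "gf2_trace N (a * x) \<in> {0, 1}" "gf2_trace N (b * x) \<in> {0, 1}"
    by (intro gf2_trace_cases gf2_mult a x)+
  show ?thesis
  proof (cases "gf2_trace N (a * x) = gf2_trace N (b * x)")
    case False
    then have "gf2_trace N (a * x) + gf2_trace N (b * x) = 1" using t by auto
    then show ?thesis
      by (intro bexI[of _ "(0, 1)"]) (simp_all add: x kerdock_bilinear_def)
  next
    case True
    define s t where "s = a + b" and "t = gf2_trace N (a * x)"
    have t: "t \<in> {0, 1}" "gf2_trace N (a * x) = t" "gf2_trace N (b * x) = t"
      using t True by (simp_all add: t_def)
    have s: "s \<in> gf2 N" "s \<noteq> 0" using a by (simp_all add: s_def gf2_add f2bar_add_eq_0_iff)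
    \<comment> \<open>The form tested against \<open>(y, 0)\<close> is \<open>tr (w y)\<close>.\<close>
    define w where "w = s * (t + \<epsilon> + s * x)"
    have te: "t + \<epsilon> \<in> {0, 1}" using t x by (intro bit_values_closed)
    have "t \<in> gf2 N" "\<epsilon> \<in> gf2 N" using t x by auto
    then have w_mem: "w \<in> gf2 N" unfolding w_def using s x by (intro gf2_mult gf2_add)
    have "w \<noteq> 0"
    proof
      assume "w = 0"
      then have sx: "s * x = t + \<epsilon>" using s by (simp add: w_def f2bar_add_eq_0_iff)
      have "gf2_trace N (s * x) = 0" by (simp add: s_def distrib_right gf2_trace_add t)
      then have "s * x \<noteq> 1" using gf2_trace_1[OF N] by auto
      then have "s * x = 0" using te sx by auto
      then have "x = 0" using s by simp
      then have "t = 0" using t by simp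
      then have "\<epsilon> = 0" using sx \<open>s * x = 0\<close> by simp
      then show False using z x \<open>x = 0\<close> by (simp add: zero_prod_def)
    qed
    moreover have "N \<ge> 1" using N by (cases N) auto
    ultimately obtain y where y: "y \<in> gf2 N" "gf2_trace N (w * y) = 1"
      using gf2_trace_nondegenerate w_mem by blast
    have "kerdock_bilinear N a z (y, 0) + kerdock_bilinear N b z (y, 0)
        = t * gf2_trace N (a * y) + t * gf2_trace N (b * y) + gf2_trace N (a * x * (a * y)) + gf2_trace N (b * x * (b * y))
          + \<epsilon> * gf2_trace N (a * y) + \<epsilon> * gf2_trace N (b * y)"
      by (simp add: kerdock_bilinear_def x t add_ac)
    also have "\<dots> = gf2_trace N (t * (a * y) + t * (b * y) + a * x * (a * y) + b * x * (b * y)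
          + \<epsilon> * (a * y) + \<epsilon> * (b * y))"
      using t x by (simp only: gf2_trace_add gf2_trace_scale_bit)
    also have "t * (a * y) + t * (b * y) + a * x * (a * y) + b * x * (b * y) + \<epsilon> * (a * y) + \<epsilon> * (b * y)
        = w * y + (a * b * x * y + a * b * x * y)"
    proof -
      have "w * y + (a * b * x * y + a * b * x * y) = t * (a * y) + t * (b * y) + a * x * (a * y)
          + b * x * (b * y) + \<epsilon> * (a * y) + \<epsilon> * (b * y)
          + ((a * b * x * y + a * b * x * y) + (a * b * x * y + a * b * x * y))"
        by (simp only: w_def s_def algebra_simps)
      then show ?thesis by (simp only: f2bar_double add_0_right)
    qed
    finally have "kerdock_bilinear N a z (y, 0) + kerdock_bilinear N b z (y, 0) = 1"
      using y by simp
    then show ?thesis using y by (intro bexI[of _ "(y, 0)"]) auto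
  qed
qed

text \<open>
  The group \<open>E \<times> {0, 1}\<close> has \<open>2\<^bsup>N+1\<^esup> = m\<close> elements, and there is one Kerdock form for each of the
  \<open>m / 2\<close> elements of \<open>E\<close>.  Its signs are real.
\<close>
lemma real_mubs_exist:
  assumes m: "CARD('n) = 4 ^ r" "CARD('n) > 2"
  shows "\<exists>(K :: nat set) (B :: nat \<Rightarrow> nat \<Rightarrow> complex ^ 'n). maximal_mub_family \<real> K B"
proof -
  have "r \<ge> 1" using m by (cases r) auto
  define N where "N = 2 * r - 1"
  have N: "odd N" "N \<ge> 1" "Suc N = 2 * r" using \<open>r \<ge> 1\<close> by (auto simp: N_def)
  have pow: "CARD('n) = 2 ^ N * 2"
    using m(1) by (metis N(3) power_Suc2 power_mult numeral_power_eq_of_nat_cancel_iff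
      power2_eq_square num_double numeral_times_numeral)
  let ?G = "gf2 N \<times> {0, 1 :: f2bar}"
  let ?\<psi> = "\<lambda>u x. bit_sign (gf2_trace N (fst u * fst x) + snd u * snd x)"
  have lin: "gf2_trace N (fst u * fst x) + snd u * snd x \<in> {0, 1}" if "u \<in> ?G" "x \<in> ?G" for u x
    using that by (intro bit_values_closed gf2_trace_cases gf2_mult) auto
  have "\<exists>(K :: nat set) (B :: nat \<Rightarrow> nat \<Rightarrow> complex ^ 'n).
      mub_family \<real> K B \<and> finite K \<and> card K = card (gf2 N) + 1"
  proof (rule quadratic_phase_mubs[where G = ?G and \<psi> = ?\<psi> and f = "\<lambda>a x. bit_sign (kerdock_quad N a x)"
        and \<beta> = "\<lambda>a x y. bit_sign (kerdock_bilinear N a x y)"])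
    show "finite ?G" using finite_gf2[OF N(2)] by simp
    show "card ?G = CARD('n)" using card_gf2[OF N(2)] pow by (simp add: card_cartesian_product)
    show "0 \<in> ?G" by (simp add: zero_prod_def)
    show "x + y \<in> ?G" if "x \<in> ?G" "y \<in> ?G" for x y
      using that by (auto intro: gf2_add)
    show "?\<psi> u x \<in> {1, - 1}" for u x by (simp add: bit_sign_def)
    show "?\<psi> u (x + y) = ?\<psi> u x * ?\<psi> u y" if "u \<in> ?G" "x \<in> ?G" "y \<in> ?G" for u x y
    proof -
      have "gf2_trace N (fst u * fst (x + y)) + snd u * snd (x + y)
          = (gf2_trace N (fst u * fst x) + snd u * snd x) + (gf2_trace N (fst u * fst y) + snd u * snd y)"
        by (simp add: distrib_left gf2_trace_add add_ac)
      then show ?thesis using bit_sign_add[OF lin lin] that by metis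
    qed
    show "\<exists>x\<in>?G. ?\<psi> u x \<noteq> ?\<psi> v x" if uv: "u \<in> ?G" "v \<in> ?G" "u \<noteq> v" for u v
    proof -
      have "\<exists>x\<in>?G. (gf2_trace N (fst u * fst x) + snd u * snd x) + (gf2_trace N (fst v * fst x) + snd v * snd x) = 1"
      proof (cases "fst u = fst v")
        case True
        then have "snd u + snd v = 1" using uv by (auto simp: prod_eq_iff)
        then show ?thesis by (intro bexI[of _ "(0, 1)"]) simp_all
      next
        case False
        then have "fst u + fst v \<in> gf2 N" "fst u + fst v \<noteq> 0"
          using uv by (auto simp: gf2_add f2bar_add_eq_0_iff)
        then obtain y where "y \<in> gf2 N" "gf2_trace N ((fst u + fst v) * y) = 1"
          using gf2_trace_nondegenerate[OF N(2)] by blast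
        then show ?thesis by (intro bexI[of _ "(y, 0)"]) (simp_all add: distrib_right gf2_trace_add)
      qed
      then show ?thesis using lin[OF uv(1)] bit_sign_neq by meson
    qed
    show "finite (gf2 N)" by (rule finite_gf2[OF N(2)])
    show "bit_sign (kerdock_quad N a x) \<in> \<real>" for a x by simp
    show "cmod (bit_sign (kerdock_quad N a x)) = 1" for a x by simp
    show "bit_sign (kerdock_quad N a (x + y)) = bit_sign (kerdock_quad N a x) * bit_sign (kerdock_quad N a y) * bit_sign (kerdock_bilinear N a x y)"
      if "a \<in> gf2 N" "x \<in> ?G" "y \<in> ?G" for a x y
      unfolding kerdock_quad_add
      using that by (simp only: bit_sign_add bit_values_closed kerdock_quad_cases kerdock_bilinear_cases)
    show "bit_sign (kerdock_bilinear N a x y) \<in> {1, - 1}" for a x y by (simp add: bit_sign_def)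
    show "bit_sign (kerdock_bilinear N a z (x + y)) = bit_sign (kerdock_bilinear N a z x) * bit_sign (kerdock_bilinear N a z y)"
      if "a \<in> gf2 N" "z \<in> ?G" "x \<in> ?G" "y \<in> ?G" for a z x y
      unfolding kerdock_bilinear_add
      using that by (simp only: bit_sign_add kerdock_bilinear_cases)
    show "\<exists>y\<in>?G. bit_sign (kerdock_bilinear N a z y) \<noteq> bit_sign (kerdock_bilinear N a' z y)"
      if "a \<in> gf2 N" "a' \<in> gf2 N" "a \<noteq> a'" "z \<in> ?G" "z \<noteq> 0" for a a' z
      using kerdock_separation[OF N(1) that] kerdock_bilinear_cases[OF that(1,4)] bit_sign_neq by meson
  qed simp
  then show ?thesis
    by (auto simp: maximal_mub_family_def mub_bound_def card_gf2[OF N(2)] pow)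
qed

text \<open>
  The rows of the character table \<open>(-1)\<^bsup>tr (x y)\<^esup>\<close> are orthogonal, and the row of \<open>0\<close> is constant.
\<close>
lemma hadamard_3_design_exists:
  assumes m: "m = 2 ^ r" "m > 2"
  shows "\<exists>S. hadamard_3_design m S"
proof -
  have r: "r \<ge> 2"
  proof (rule ccontr)
    assume "\<not> r \<ge> 2"
    then have "r = 0 \<or> r = 1" by linarith
    then show False using m by auto
  qed
  then have r1: "r \<ge> 1" by simp
  obtain h0 where h0: "bij_betw h0 {1..m} (gf2 r)"
    using ex_bij_betw_nat_finite_1[OF finite_gf2[OF r1]] card_gf2[OF r1] m by auto
  have m_mem: "m \<in> {1..m}" using m by simp
  have h0_mem: "h0 j \<in> gf2 r" if "j \<in> {1..m}" for j using h0 that by (auto simp: bij_betw_def)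
  \<comment> \<open>Translate the enumeration so that the last row belongs to \<open>0\<close>.\<close>
  define h where "h j = h0 j + h0 m" for j
  have h_mem: "h j \<in> gf2 r" if "j \<in> {1..m}" for j
    using that m_mem by (simp add: h_def gf2_add h0_mem del: atLeastAtMost_iff)
  have h_inj: "h i \<noteq> h j" if "i \<in> {1..m}" "j \<in> {1..m}" "i \<noteq> j" for i j
    using that h0 by (simp add: h_def) (metis bij_betw_def inj_on_eq_iff atLeastAtMost_iff One_nat_def)
  have h: "bij_betw h {1..m} (gf2 r)"
  proof (rule bij_betw_imageI)
    show inj: "inj_on h {1..m}" using h_inj by (meson inj_onI)
    show "h ` {1..m} = gf2 r"
    proof (rule card_subset_eq[OF finite_gf2[OF r1]])
      show "card (h ` {1..m}) = card (gf2 r)"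
        using card_image[OF inj] card_gf2[OF r1] m by simp
    qed (use h_mem in auto)
  qed
  define H :: "nat \<Rightarrow> nat \<Rightarrow> int" where "H i j = (if gf2_trace r (h i * h j) = 0 then 1 else - 1)" for i j
  have "(\<Sum>j=1..m. H i j * H i' j) = 0" if i: "i \<in> {1..m}" "i' \<in> {1..m}" "i \<noteq> i'" for i i'
  proof -
    let ?\<psi> = "\<lambda>y. bit_sign (gf2_trace r ((h i + h i') * y))"
    have s: "h i + h i' \<in> gf2 r" "h i + h i' \<noteq> 0"
      using h_mem h_inj i by (simp_all add: gf2_add f2bar_add_eq_0_iff del: atLeastAtMost_iff)
    then obtain a where a: "a \<in> gf2 r" "gf2_trace r ((h i + h i') * a) = 1"
      using gf2_trace_nondegenerate[OF r1] by blast
    have "of_int (\<Sum>j=1..m. H i j * H i' j) = (\<Sum>j=1..m. bit_sign (gf2_trace r (h i * h j)) * bit_sign (gf2_trace r (h i' * h j)))"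
      by (simp add: H_def bit_sign_def of_int_sum) (intro sum.cong; simp)
    also have "\<dots> = (\<Sum>j=1..m. ?\<psi> (h j))"
      unfolding distrib_right gf2_trace_add
      using i h_mem by (intro sum.cong refl bit_sign_add[symmetric] gf2_trace_cases gf2_mult) auto
    also have "\<dots> = (\<Sum>y\<in>gf2 r. ?\<psi> y)" by (rule sum.reindex_bij_betw[OF h])
    also have "\<dots> = 0"
    proof (rule character_sum_0[of _ _ a])
      show "?\<psi> (x + y) = ?\<psi> x * ?\<psi> y" if "x \<in> gf2 r" "y \<in> gf2 r" for x y
        unfolding distrib_left[of "h i + h i'"] gf2_trace_add using that s by (intro bit_sign_add gf2_trace_cases gf2_mult)
    qed (use a r1 in \<open>simp_all add: finite_gf2 gf2_add\<close>)
    finally show ?thesis by (simp only: of_int_eq_0_iff)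
  qed
  then have had: "hadamard_matrix m H" by (auto simp: hadamard_matrix_def H_def)
  have r2: "2 + (r - 2) = r" using r by simp
  have "m = 2 ^ (2 + (r - 2))" unfolding r2 by (rule m(1))
  also have "\<dots> = 4 * 2 ^ (r - 2)" unfolding power_add by simp
  finally have "m = 4 * 2 ^ (r - 2)" .
  moreover have "\<forall>j\<in>{1..m}. H m j = 1" by (simp add: H_def h_def)
  ultimately show ?thesis
    using hadamard_matrix_imp_3_design[of "2 ^ (r - 2)" H] had by auto
qed

section \<open>The characterisation\<close>

theorem theorem6p26:
  shows
    "(\<forall>(F :: complex set) (S :: nat set set) (l :: nat) (K :: 'k set)
        (B :: 'k \<Rightarrow> nat \<Rightarrow> complex ^ 'n).
        (F = \<real> \<or> F = UNIV) \<and>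
        (\<forall>J\<in>S. J \<subseteq> {1..CARD('n)} \<and> card J = l) \<and>
        maximal_mub_family F K B \<longrightarrow>
        (hadamard_3_design CARD('n) S \<longrightarrow>
           max_orthoplectic_ff F (mub_projections K B S) \<and>
           constant_rank (mub_projections K B S)) \<and>
        (CARD('n) > 2 \<and>
         max_orthoplectic_ff F (mub_projections K B S) \<and>
         constant_rank (mub_projections K B S) \<longrightarrow>
           hadamard_3_design CARD('n) S))
   \<and> ((\<exists>r. CARD('n) = 2 ^ r) \<longrightarrow>
        (CARD('n) > 2 \<longrightarrow>
           (\<exists>S. hadamard_3_design CARD('n) S) \<and>
           (\<exists>(K :: nat set) (B :: nat \<Rightarrow> nat \<Rightarrow> complex ^ 'n). maximal_mub_family UNIV K B)) \<and>
        (\<forall>S (K :: 'k set) (B :: 'k \<Rightarrow> nat \<Rightarrow> complex ^ 'n).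
           hadamard_3_design CARD('n) S \<and> maximal_mub_family UNIV K B \<longrightarrow>
             max_orthoplectic_ff UNIV (mub_projections K B S)))
   \<and> ((\<exists>r. CARD('n) = 4 ^ r) \<longrightarrow>
        (CARD('n) > 2 \<longrightarrow>
           (\<exists>S. hadamard_3_design CARD('n) S) \<and>
           (\<exists>(K :: nat set) (B :: nat \<Rightarrow> nat \<Rightarrow> complex ^ 'n). maximal_mub_family \<real> K B)) \<and>
        (\<forall>S (K :: 'k set) (B :: 'k \<Rightarrow> nat \<Rightarrow> complex ^ 'n).
           hadamard_3_design CARD('n) S \<and> maximal_mub_family \<real> K B \<longrightarrow>
             max_orthoplectic_ff \<real> (mub_projections K B S)))"
proof -
  have four: "4 ^ r = (2 ^ (2 * r) :: nat)" for r
    by (simp add: power_mult)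
  have design: "\<exists>S. hadamard_3_design CARD('n) S" if "CARD('n) = 4 ^ r" "CARD('n) > 2" for r
    using hadamard_3_design_exists[of "CARD('n)" "2 * r"] that four by simp
  show ?thesis
    by (intro conjI allI impI; (elim conjE exE)?;
        rule hadamard_imp_frame[THEN conjunct1] hadamard_imp_frame[THEN conjunct2] frame_imp_hadamard
          hadamard_3_design_exists design complex_mubs_exist real_mubs_exist;
        (assumption | simp))
qed

end
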